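(* Let $G$ be a directed graph on vertex set $[n]$ and $S$ a subset of its edges, and write $$\omega\,\mathrm G_{G,S}(\mathbf x;q+1)=\sum_{\alpha\vDash n}c^{G,S}_\alpha(q)\frac{\Psi_\alpha(\mathbf x)}{z_\alpha}.$$ Then $c^{G,S}_\alpha(q)\in\mathbb N[q]$ for all compositions $\alpha$.
   Context: For a coloring $\kappa:[n]\to\mathbb Z_{>0}$, $\mathrm{asc}(\kappa)$ is the number of directed edges $(i,j)$ (with multiplicity) of $G$ with $\kappa(i)<\kappa(j)$. The vertical strip graph LLT polynomial is $\mathrm G_{G,S}(\mathbf x;q)=\sum_\kappa x_{\kappa(1)}\cdots x_{\kappa(n)}q^{\mathrm{asc}(\kappa)-|S|}$, summed over all colorings $\kappa$ with $\kappa(i)<\kappa(j)$ for every directed edge $(i,j)\in S$. $\omega$ is the linear automorphism of quasisymmetric functions with $\omega(F_{n,T})=F_{n,[n-1]\setminus(n-T)}$, where $F_{n,T}=\sum_{j_1\le\dots\le j_n,\ j_i<j_{i+1}\ (i\in T)}x_{j_1}\cdots x_{j_n}$ and $n-T=\{n-t:t\in T\}$, extended coefficientwise in $q$. For compositions: $S_\alpha=\{\alpha_1,\dots,\alpha_1+\dots+\alpha_{\ell-1}\}$, blocks $B_i(\alpha)$ consecutive intervals of sizes $\alpha_i$, $\alpha\le\beta$ iff $S_\beta\subseteq S_\alpha$; $M_\alpha=\sum_{i_1<\dots<i_\ell}x_{i_1}^{\alpha_1}\cdots x_{i_\ell}^{\alpha_\ell}$; $z_\alpha=\prod_i i^{m_i}m_i!$;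 $\pi(\gamma)=\prod_i(\gamma_1+\dots+\gamma_i)$; $\pi(\alpha,\beta)=\prod_i\pi(\alpha^{(i)})$ with $\alpha^{(i)}$ the parts of $\alpha$ whose blocks lie in $B_i(\beta)$; $\Psi_\alpha=z_\alpha\sum_{\beta\ge\alpha}\pi(\alpha,\beta)^{-1}M_\beta$. *)

theory Defs
  imports "HOL-Computational_Algebra.Polynomial" "HOL-Library.Multiset" "HOL-Library.FuncSet"
begin

text \<open>Formal power series in the variables x_1, x_2, ... are represented by their
coefficient functions: a monomial is an exponent vector e :: nat => nat (e j = exponent
of x_j; index 0 is unused, variables are indexed by positive integers), and a series with
coefficients in rat poly (polynomials in q) is a map from exponent vectors to rat poly.
A directed multigraph on [n] = {1..n} is a finite multiset of ordered pairs.\<close>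

type_synonym series = "(nat \<Rightarrow> nat) \<Rightarrow> rat poly"

definition colorings :: "nat \<Rightarrow> (nat \<Rightarrow> nat) set" where
  "colorings n = PiE {1..n} (\<lambda>_. {1..})"

definition content :: "nat \<Rightarrow> (nat \<Rightarrow> nat) \<Rightarrow> nat \<Rightarrow> nat" where
  "content n \<kappa> j = card {i \<in> {1..n}. \<kappa> i = j}"

definition asc :: "(nat \<times> nat) multiset \<Rightarrow> (nat \<Rightarrow> nat) \<Rightarrow> nat" where
  "asc E \<kappa> = size (filter_mset (\<lambda>(i, j). \<kappa> i < \<kappa> j) E)"

text \<open>Coefficient of x^e in the vertical strip graph LLT polynomial G_{G,S}(x; q),
  evaluated at q := Q (Q = [:0,1:] gives G(x;q), Q = [:1,1:] gives G(x;q+1)).\<close>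
definition LLT_at :: "nat \<Rightarrow> (nat \<times> nat) multiset \<Rightarrow> (nat \<times> nat) multiset \<Rightarrow> rat poly \<Rightarrow> series" where
  "LLT_at n E S Q e =
     (\<Sum>\<kappa> \<in> {\<kappa> \<in> colorings n. (\<forall>(i, j) \<in> set_mset S. \<kappa> i < \<kappa> j) \<and> content n \<kappa> = e}.
        Q ^ (asc E \<kappa> - size S))"

definition Fcoeff :: "nat \<Rightarrow> nat set \<Rightarrow> (nat \<Rightarrow> nat) \<Rightarrow> nat" where
  "Fcoeff n T e = card {j \<in> colorings n.
      (\<forall>i \<in> {1..<n}. j i \<le> j (Suc i)) \<and> (\<forall>i \<in> T. j i < j (Suc i)) \<and> content n j = e}"

definition Fseries :: "nat \<Rightarrow> (nat set \<Rightarrow> rat poly) \<Rightarrow> series" where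
  "Fseries n d e = (\<Sum>T \<in> Pow {1..<n}. d T * of_nat (Fcoeff n T e))"

definition omega_set :: "nat \<Rightarrow> nat set \<Rightarrow> nat set" where
  "omega_set n T = {1..<n} - (\<lambda>t. n - t) ` T"

definition comps :: "nat \<Rightarrow> nat list set" where
  "comps n = {\<alpha>. 0 \<notin> set \<alpha> \<and> sum_list \<alpha> = n}"

definition Sset :: "nat list \<Rightarrow> nat set" where
  "Sset \<alpha> = {sum_list (take k \<alpha>) | k. 1 \<le> k \<and> k < length \<alpha>}"

definition block :: "nat list \<Rightarrow> nat \<Rightarrow> nat set" where
  "block \<alpha> k = {sum_list (take k \<alpha>) + 1 .. sum_list (take (Suc k) \<alpha>)}"

definition comp_le :: "nat list \<Rightarrow> nat list \<Rightarrow> bool" where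
  "comp_le \<alpha> \<beta> \<longleftrightarrow> Sset \<beta> \<subseteq> Sset \<alpha>"

definition Mcoeff :: "nat list \<Rightarrow> (nat \<Rightarrow> nat) \<Rightarrow> nat" where
  "Mcoeff \<beta> e = card {i \<in> PiE {..<length \<beta>} (\<lambda>_. {1..}).
      (\<forall>k. Suc k < length \<beta> \<longrightarrow> i k < i (Suc k)) \<and>
      (\<forall>c. e c = (\<Sum>k \<in> {k. k < length \<beta> \<and> i k = c}. \<beta> ! k))}"

definition zee :: "nat list \<Rightarrow> nat" where
  "zee \<alpha> = (\<Prod>i \<in> set \<alpha>. i ^ count (mset \<alpha>) i * fact (count (mset \<alpha>) i))"

definition pi_comp :: "nat list \<Rightarrow> nat" where
  "pi_comp \<gamma> = (\<Prod>k < length \<gamma>. sum_list (take (Suc k) \<gamma>))"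

definition sub_comp :: "nat list \<Rightarrow> nat list \<Rightarrow> nat \<Rightarrow> nat list" where
  "sub_comp \<alpha> \<beta> i = [\<alpha> ! k. k \<leftarrow> [0..<length \<alpha>], block \<alpha> k \<subseteq> block \<beta> i]"

definition pi_pair :: "nat list \<Rightarrow> nat list \<Rightarrow> nat" where
  "pi_pair \<alpha> \<beta> = (\<Prod>i < length \<beta>. pi_comp (sub_comp \<alpha> \<beta> i))"

definition Psi :: "nat \<Rightarrow> nat list \<Rightarrow> (nat \<Rightarrow> nat) \<Rightarrow> rat" where
  "Psi n \<alpha> e = of_nat (zee \<alpha>) *
     (\<Sum>\<beta> \<in> {\<beta> \<in> comps n. comp_le \<alpha> \<beta>}. of_nat (Mcoeff \<beta> e) / of_nat (pi_pair \<alpha> \<beta>))"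

definition Psi_expansion :: "nat \<Rightarrow> (nat list \<Rightarrow> rat poly) \<Rightarrow> series" where
  "Psi_expansion n c e = (\<Sum>\<alpha> \<in> comps n. smult (Psi n \<alpha> e / of_nat (zee \<alpha>)) (c \<alpha>))"

definition nat_poly :: "rat poly \<Rightarrow> bool" where
  "nat_poly p \<longleftrightarrow> (\<forall>k. coeff p k \<in> \<nat>)"

end

(* (1+q)^asc expands over subsets of the edges outside S, so it suffices to treat the strict
   order-preserving maps of a finite poset (a directed cycle admits none). In the monomial basis
   omega is an alternating sum over refinements. Removing the last block of an ordered set
   partition shows two identities for every poset X: the signed number of its partitions into
   blocks of minimal elements is 1 (the nonempty subsets of the minimal elements of X, counted
   with sign (-1)^(|Z|-1), sum to 1), and its partitions into principal down-sets, weighted by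
   1/pi, sum to 1 (every element of X generates one last block, and each has weight 1/|X|).
   Applied to each block of a coarser composition, both sums count the same weakly
   order-preserving maps; the second one is a Psi expansion with natural coefficients. *)

theory Submission
  imports Defs
begin

text \<open>The reflection T -> n - T inside omega replaces the monomial coefficient at \<alpha> by
  the one at \<open>rev \<alpha>\<close>. This fixes all orientations: a composition lists blocks
  from the top of the poset downwards, while \<open>chains\<close> builds partitions from the
  bottom, so the last part of a composition is the size of the first block of a chain. The partial
  sums in \<open>pi_comp\<close> are then the numbers of elements present before each removal; the
  largest is |X|, whence the uniform weight 1/|X| on the principal down-sets. The signed term and
  the 1/pi term of a single \<alpha> differ in general. Only their sums over all refinements of each
  \<beta> agree, and these sums are precisely the M_\<beta>-coefficients of the two series, so the
  comparison is made there. The theorem concerns every F-expansion d and every Psi-expansion c, so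
  existence and uniqueness are needed as well. Moebius inversion over subsets yields d;
  triangularity of the Psi_\<alpha> for refinement shows that c must be the expansion found by
  counting.\<close>

section \<open>Compositions\<close>

text \<open>Partial sums including 0 and the total, so that no boundary case arises in concatenations.\<close>

primrec psums :: "nat list \<Rightarrow> nat set" where
  "psums [] = {0}"
| "psums (a # \<alpha>) = insert 0 ((+) a ` psums \<alpha>)"

lemma psums_append: "psums (\<alpha> @ \<beta>) = psums \<alpha> \<union> (+) (sum_list \<alpha>) ` psums \<beta>"
proof (induction \<alpha>)
  case Nil
  have "0 \<in> psums \<beta>" by (cases \<beta>) auto
  then show ?case by auto
next
  case (Cons a \<alpha>)
  then show ?case by (auto simp: image_Un image_image add.assoc)
qed

lemma zero_in_psums [simp]: "0 \<in> psums \<alpha>"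
  by (cases \<alpha>) auto

lemma sum_list_in_psums [simp]: "sum_list \<alpha> \<in> psums \<alpha>"
  by (induction \<alpha>) auto

lemma psums_le: "x \<in> psums \<alpha> \<Longrightarrow> x \<le> sum_list \<alpha>"
  by (induction \<alpha> arbitrary: x) auto

lemma finite_psums [simp]: "finite (psums \<alpha>)"
  by (induction \<alpha>) auto

lemma psums_eq_take: "psums \<alpha> = (\<lambda>k. sum_list (take k \<alpha>)) ` {..length \<alpha>}"
proof (induction \<alpha>)
  case (Cons a \<alpha>)
  have *: "{..length (a # \<alpha>)} = insert 0 (Suc ` {..length \<alpha>})"
    using atMost_Suc_eq_insert_0 by simp
  show ?case unfolding * image_insert image_image by (simp add: Cons image_image)
qed auto

lemma in_compsD:
  assumes "\<alpha> \<in> comps n"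
  shows "0 \<notin> set \<alpha>" "sum_list \<alpha> = n"
  using assms by (auto simp: comps_def)

lemma length_le_sum_list: "0 \<notin> set \<alpha> \<Longrightarrow> length \<alpha> \<le> sum_list (\<alpha> :: nat list)"
  by (induction \<alpha>) auto

lemma sum_list_eq_0: "0 \<notin> set \<alpha> \<Longrightarrow> sum_list (\<alpha> :: nat list) = 0 \<longleftrightarrow> \<alpha> = []"
  by (cases \<alpha>) auto

lemma finite_comps [simp]: "finite (comps n)"
proof (rule finite_subset)
  show "comps n \<subseteq> {\<alpha>. set \<alpha> \<subseteq> {..n} \<and> length \<alpha> \<le> n}"
    using length_le_sum_list by (auto simp: comps_def intro: member_le_sum_list)
  show "finite {\<alpha>. set \<alpha> \<subseteq> {..n} \<and> length \<alpha> \<le> n}"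
    by (rule finite_lists_length_le) simp
qed

lemma comps_0 [simp]: "comps 0 = {[]}"
  using sum_list_eq_0 by (auto simp: comps_def)

lemma take_sum_list_less:
  assumes "0 \<notin> set \<alpha>" "j < k" "k \<le> length \<alpha>"
  shows "sum_list (take j \<alpha>) < sum_list (take k (\<alpha> :: nat list))"
proof -
  have "take k \<alpha> = take j \<alpha> @ take (k - j) (drop j \<alpha>)"
    using assms by (metis le_add_diff_inverse less_imp_le_nat take_add)
  moreover have "take (k - j) (drop j \<alpha>) \<noteq> []" "0 \<notin> set (take (k - j) (drop j \<alpha>))"
    using assms by (auto dest: in_set_takeD in_set_dropD)
  ultimately show ?thesis using sum_list_eq_0 by fastforce
qed

lemma card_psums: "0 \<notin> set \<alpha> \<Longrightarrow> card (psums \<alpha>) = Suc (length \<alpha>)"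
proof -
  assume "0 \<notin> set \<alpha>"
  then have "inj_on (\<lambda>k. sum_list (take k \<alpha>)) {..length \<alpha>}"
    by (intro linorder_inj_onI) (metis atMost_iff less_irrefl take_sum_list_less, simp add: linear)
  then show ?thesis by (simp add: psums_eq_take card_image)
qed

lemma Sset_eq_psums:
  assumes "0 \<notin> set \<alpha>"
  shows "Sset \<alpha> = psums \<alpha> - {0, sum_list \<alpha>}"
proof (intro equalityI subsetI)
  fix x assume "x \<in> Sset \<alpha>"
  then obtain k where k: "x = sum_list (take k \<alpha>)" "1 \<le> k" "k < length \<alpha>"
    by (auto simp: Sset_def)
  have "0 < x" using take_sum_list_less[OF assms, of 0 k] k by simp
  moreover have "x < sum_list \<alpha>" using take_sum_list_less[OF assms, of k "length \<alpha>"] k by simp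
  moreover have "x \<in> psums \<alpha>" unfolding psums_eq_take using k by (intro image_eqI[of _ _ k]) auto
  ultimately show "x \<in> psums \<alpha> - {0, sum_list \<alpha>}" by blast
next
  fix x assume x: "x \<in> psums \<alpha> - {0, sum_list \<alpha>}"
  then obtain k where k: "x = sum_list (take k \<alpha>)" "k \<le> length \<alpha>"
    by (auto simp: psums_eq_take)
  moreover have "k \<noteq> 0" using x k(1) by (intro notI) simp
  moreover have "k \<noteq> length \<alpha>" using x k(1) by (intro notI) simp
  ultimately show "x \<in> Sset \<alpha>" unfolding Sset_def by (intro CollectI exI[of _ k]) auto
qed

lemma Sset_subset: "\<alpha> \<in> comps n \<Longrightarrow> Sset \<alpha> \<subseteq> {1..<n}"
  using psums_le by (fastforce simp: comps_def Sset_eq_psums)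

lemma psums_eq_Sset: "\<alpha> \<in> comps n \<Longrightarrow> psums \<alpha> = Sset \<alpha> \<union> {0, n}"
  by (auto simp: comps_def Sset_eq_psums)

lemma comp_le_iff_psums:
  "\<alpha> \<in> comps n \<Longrightarrow> \<beta> \<in> comps n \<Longrightarrow> comp_le \<alpha> \<beta> \<longleftrightarrow> psums \<beta> \<subseteq> psums \<alpha>"
  by (auto simp: comps_def Sset_eq_psums comp_le_def)

lemma psums_rev: "psums (rev \<alpha>) = (\<lambda>x. sum_list \<alpha> - x) ` psums \<alpha>"
proof (induction \<alpha>)
  case (Cons a \<alpha>)
  have "psums (rev (a # \<alpha>)) = (\<lambda>x. sum_list \<alpha> - x) ` psums \<alpha> \<union> {sum_list \<alpha>, sum_list \<alpha> + a}"
    by (simp add: psums_append Cons)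
  moreover have "sum_list \<alpha> \<in> (\<lambda>x. sum_list \<alpha> - x) ` psums \<alpha>"
    by (metis diff_zero image_eqI zero_in_psums)
  ultimately show ?case by (simp add: image_image add.commute insert_absorb)
qed auto

lemma rev_in_comps [simp]: "rev \<alpha> \<in> comps n \<longleftrightarrow> \<alpha> \<in> comps n"
  by (simp add: comps_def)

text \<open>Reversal is the reflection half of omega; the other half is complementation of cut
  sets.\<close>

lemma Sset_rev: "\<alpha> \<in> comps n \<Longrightarrow> Sset (rev \<alpha>) = (\<lambda>x. n - x) ` Sset \<alpha>"
proof -
  assume a: "\<alpha> \<in> comps n"
  then have "\<And>x. x \<in> psums \<alpha> \<Longrightarrow> x \<le> n" using psums_le by (auto simp: comps_def)
  then show ?thesis using a
    by (fastforce simp: comps_def Sset_eq_psums psums_rev)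
qed

text \<open>The first part is the least nonzero partial sum, so the set of partial sums determines
  the list part by part.\<close>

lemma psums_inject:
  assumes "0 \<notin> set \<alpha>" "0 \<notin> set \<beta>" "psums \<alpha> = psums \<beta>"
  shows "\<alpha> = \<beta>"
  using assms
proof (induction \<alpha> arbitrary: \<beta>)
  case Nil
  then have "card (psums \<beta>) = 1" by (metis card_1_singleton_iff psums.simps(1) One_nat_def)
  with Nil show ?case using card_psums by fastforce
next
  case (Cons a \<alpha>)
  then have "card (psums \<beta>) = Suc (length (a # \<alpha>))" using card_psums by metis
  then obtain b \<beta>' where b: "\<beta> = b # \<beta>'" using Cons.prems card_psums by (cases \<beta>) fastforce+
  have ab: "a > 0" "b > 0" using Cons.prems b by auto
  have eq: "insert 0 ((+) a ` psums \<alpha>) = insert 0 ((+) b ` psums \<beta>')" using Cons.prems b by simp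
  have "a + 0 \<in> insert 0 ((+) b ` psums \<beta>')" "b + 0 \<in> insert 0 ((+) a ` psums \<alpha>)"
    using eq zero_in_psums by blast+
  then have "b \<le> a" "a \<le> b" using ab by auto
  then have "a = b" by simp
  moreover have "(+) a ` psums \<alpha> = (+) a ` psums \<beta>'"
  proof -
    have "0 \<notin> (+) a ` psums \<alpha>" "0 \<notin> (+) a ` psums \<beta>'" using ab by auto
    then show ?thesis using eq \<open>a = b\<close> by (metis insert_ident)
  qed
  then have "psums \<alpha> = psums \<beta>'" by (metis inj_image_eq_iff inj_on_add)
  ultimately show ?case using Cons b by auto
qed

text \<open>Points are added in increasing order. The previous maximum is
  \<open>sum_list \<alpha>\<close>, so a new maximum b contributes the part
  \<open>b - sum_list \<alpha>\<close>.\<close>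

lemma psums_surj:
  assumes "finite A" "0 \<notin> A"
  shows "\<exists>\<alpha>. 0 \<notin> set \<alpha> \<and> psums \<alpha> = insert 0 A"
  using assms
proof (induction rule: finite_linorder_max_induct)
  case empty
  then show ?case by (intro exI[of _ "[]"]) auto
next
  case (insert b A)
  then obtain \<alpha> where \<alpha>: "0 \<notin> set \<alpha>" "psums \<alpha> = Set.insert 0 A" by auto
  then have mem: "sum_list \<alpha> \<in> Set.insert 0 A" using sum_list_in_psums by metis
  moreover have "b > 0" using insert.prems by (intro Nat.gr0I) auto
  ultimately have less: "sum_list \<alpha> < b" using mem insert.hyps(2) by (metis Set.insertE)
  then have "0 \<notin> set (\<alpha> @ [b - sum_list \<alpha>])" using \<alpha> by simp
  moreover have "psums (\<alpha> @ [b - sum_list \<alpha>]) = Set.insert 0 A \<union> {sum_list \<alpha>, b}"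
    using \<alpha> less by (simp add: psums_append)
  then have "psums (\<alpha> @ [b - sum_list \<alpha>]) = Set.insert 0 (Set.insert b A)" using mem by blast
  ultimately show ?case by blast
qed

lemma sum_list_eq_Max: "sum_list \<alpha> = Max (psums \<alpha>)"
  by (rule sym, rule Max_eqI) (auto dest: psums_le)

lemma bij_betw_Sset: "bij_betw Sset (comps n) (Pow {1..<n})"
proof (rule bij_betwI')
  fix \<alpha> \<beta> assume "\<alpha> \<in> comps n" "\<beta> \<in> comps n"
  then show "Sset \<alpha> = Sset \<beta> \<longleftrightarrow> \<alpha> = \<beta>"
    by (metis psums_inject psums_eq_Sset in_compsD(1))
next
  fix \<alpha> assume "\<alpha> \<in> comps n"
  then show "Sset \<alpha> \<in> Pow {1..<n}" using Sset_subset by auto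
next
  fix U assume U: "U \<in> Pow {1..<n}"
  then have fin: "finite U" using finite_subset by blast
  have "0 \<notin> U" using U by auto
  \<comment> \<open>\<open>{n} - {0}\<close> adds the total n without putting 0 into the set when n
    = 0, as \<open>psums_surj\<close> requires.\<close>
  then obtain \<alpha> where \<alpha>: "0 \<notin> set \<alpha>" "psums \<alpha> = insert 0 (U \<union> ({n} - {0}))"
    using psums_surj[of "U \<union> ({n} - {0})"] fin by auto
  have "sum_list \<alpha> = n" unfolding sum_list_eq_Max \<alpha>(2)
    by (rule Max_eqI) (use U fin in \<open>auto\<close>)
  with \<alpha> U have "\<alpha> \<in> comps n" "U = Sset \<alpha>" by (auto simp: comps_def Sset_eq_psums)
  then show "\<exists>\<alpha>\<in>comps n. U = Sset \<alpha>" by blast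
qed

text \<open>For n > 0 there are \<open>length \<alpha> - 1\<close> cut points among n - 1 positions;
  for n = 0 both sides vanish. This converts the parity of a complement into the sign
  \<open>(-1) ^ (n + length \<alpha>)\<close>.\<close>

lemma card_compl_Sset:
  assumes "\<alpha> \<in> comps n"
  shows "card ({1..<n} - Sset \<alpha>) = n - length \<alpha>"
proof -
  have "psums \<alpha> = Sset \<alpha> \<union> {0, n}" "0 \<notin> Sset \<alpha>" "n \<notin> Sset \<alpha>" "finite (Sset \<alpha>)"
    using assms psums_eq_Sset Sset_subset[OF assms] finite_subset[OF Sset_subset[OF assms]] by auto
  then have "card (psums \<alpha>) = card (Sset \<alpha>) + card {0, n}"
    by (simp only: card_Un_disjoint finite.intros Int_insert_right Int_empty_right if_False)
  moreover have "card (psums \<alpha>) = Suc (length \<alpha>)" using assms by (simp add: card_psums comps_def)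
  moreover have "card ({1..<n} - Sset \<alpha>) = card {1..<n} - card (Sset \<alpha>)"
    using Sset_subset[OF assms] by (intro card_Diff_subset) (auto intro: finite_subset)
  ultimately show ?thesis by (cases "n = 0") auto
qed

section \<open>Refinements of a composition and the factorization of pi along them\<close>

lemma refinement_Cons_bij:
  assumes "b > 0" "sum_list \<beta> = m"
  shows "bij_betw (\<lambda>(\<gamma>, \<alpha>). \<gamma> @ \<alpha>) (comps b \<times> {\<alpha> \<in> comps m. psums \<beta> \<subseteq> psums \<alpha>})
           {\<alpha> \<in> comps (b + m). psums (b # \<beta>) \<subseteq> psums \<alpha>}"
  unfolding bij_betw_def
proof
  show "inj_on (\<lambda>(\<gamma>, \<alpha>). \<gamma> @ \<alpha>) (comps b \<times> {\<alpha> \<in> comps m. psums \<beta> \<subseteq> psums \<alpha>})"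
  proof (rule inj_onI, clarify)
    fix \<gamma> \<alpha> \<gamma>' \<alpha>' assume *: "\<gamma> \<in> comps b" "\<gamma>' \<in> comps b" "\<gamma> @ \<alpha> = \<gamma>' @ \<alpha>'"
    then obtain us where us: "\<gamma> = \<gamma>' @ us \<or> \<gamma>' = \<gamma> @ us"
      using append_eq_append_conv2[of \<gamma> \<alpha> \<gamma>' \<alpha>'] by blast
    \<comment> \<open>Two decompositions of one list differ by a segment of positive parts with sum
      0, which must be empty.\<close>
    have "0 \<notin> set us \<and> sum_list us = 0"
      using us
    proof (elim disjE)
      assume "\<gamma> = \<gamma>' @ us"
      then show ?thesis using in_compsD[OF *(1)] in_compsD[OF *(2)] by simp
    next
      assume "\<gamma>' = \<gamma> @ us"
      then show ?thesis using in_compsD[OF *(1)] in_compsD[OF *(2)] by simp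
    qed
    then have "us = []" using sum_list_eq_0 by blast
    with us have "\<gamma> = \<gamma>'" by auto
    with *(3) show "\<gamma> = \<gamma>' \<and> \<alpha> = \<alpha>'" by simp
  qed
  show "(\<lambda>(\<gamma>, \<alpha>). \<gamma> @ \<alpha>) ` (comps b \<times> {\<alpha> \<in> comps m. psums \<beta> \<subseteq> psums \<alpha>}) =
    {\<alpha> \<in> comps (b + m). psums (b # \<beta>) \<subseteq> psums \<alpha>}" (is "?f ` ?A = ?B")
  proof (intro equalityI subsetI)
    fix x assume "x \<in> ?f ` ?A"
    then show "x \<in> ?B" by (auto simp: comps_def psums_append)
  next
    fix \<delta> assume \<delta>: "\<delta> \<in> ?B"
    have "b + 0 \<in> psums \<delta>" using \<delta> by (metis (no_types, lifting) image_eqI insertI2 mem_Collect_eq psums.simps(2) subset_eq zero_in_psums)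
    then obtain k where k: "b = sum_list (take k \<delta>)" by (auto simp: psums_eq_take)
    define \<gamma> \<alpha> where "\<gamma> = take k \<delta>" and "\<alpha> = drop k \<delta>"
    have eq: "\<delta> = \<gamma> @ \<alpha>" by (simp add: \<gamma>_def \<alpha>_def)
    have g: "\<gamma> \<in> comps b" using \<delta> k by (auto simp: \<gamma>_def comps_def dest: in_set_takeD)
    have a: "\<alpha> \<in> comps m" using \<delta> g unfolding eq by (auto simp: comps_def)
    have "psums \<beta> \<subseteq> psums \<alpha>"
    proof
      fix x assume x: "x \<in> psums \<beta>"
      then have "b + x \<in> psums \<delta>" using \<delta> by auto
      then have "b + x \<in> psums \<gamma> \<or> x \<in> psums \<alpha>" using in_compsD[OF g]
        by (auto simp: eq psums_append)
      then show "x \<in> psums \<alpha>" using psums_le[of "b + x" \<gamma>] in_compsD[OF g] by (cases "x = 0") auto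
    qed
    with g a eq show "\<delta> \<in> ?f ` ?A" by force
  qed
qed

text \<open>A refinement of \<open>b # \<beta>\<close> has b among its partial sums; cutting there
  leaves a composition of b and a refinement of \<beta>, chosen independently.\<close>

lemma sum_refinements_Cons:
  assumes "b > 0"
  shows "(\<Sum>\<alpha> | \<alpha> \<in> comps (sum_list (b # \<beta>)) \<and> psums (b # \<beta>) \<subseteq> psums \<alpha>. H \<alpha>) =
         (\<Sum>\<gamma>\<in>comps b. \<Sum>\<alpha> | \<alpha> \<in> comps (sum_list \<beta>) \<and> psums \<beta> \<subseteq> psums \<alpha>. H (\<gamma> @ \<alpha>))"
  using sum.reindex_bij_betw[OF refinement_Cons_bij[OF assms refl, of \<beta>], of H]
  by (simp add: sum.cartesian_product case_prod_unfold)

lemma block_append_left: "k < length \<gamma> \<Longrightarrow> block (\<gamma> @ \<alpha>) k = block \<gamma> k"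
  by (simp add: block_def)

lemma block_append_right:
  "block (\<gamma> @ \<alpha>) (length \<gamma> + k) = (+) (sum_list \<gamma>) ` block \<alpha> k"
  by (simp add: block_def add.assoc)

lemma block_Cons_Suc: "block (b # \<beta>) (Suc k) = (+) b ` block \<beta> k"
  by (simp add: block_def add.assoc)

lemma block_subset: "block \<gamma> k \<subseteq> {1..sum_list \<gamma>}"
proof -
  have "sum_list (take (Suc k) \<gamma>) \<le> sum_list \<gamma>"
    by (metis append_take_drop_id le_add1 sum_list_append)
  then show ?thesis by (auto simp: block_def)
qed

lemma block_nonempty: "0 \<notin> set \<gamma> \<Longrightarrow> k < length \<gamma> \<Longrightarrow> block \<gamma> k \<noteq> {}"
  using take_sum_list_less[of \<gamma> k "Suc k"] by (auto simp: block_def)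

lemma sub_comp_eq_filter:
  "sub_comp \<alpha> \<beta> i = map ((!) \<alpha>) (filter (\<lambda>k. block \<alpha> k \<subseteq> block \<beta> i) [0..<length \<alpha>])"
proof -
  have "concat (map (\<lambda>k. if P k then [f k] else []) xs) = map f (filter P xs)"
    for P :: "nat \<Rightarrow> bool" and f :: "nat \<Rightarrow> nat" and xs
    by (induction xs) auto
  then show ?thesis by (simp add: sub_comp_def)
qed

text \<open>Containment of blocks identifies the coarse block only because all parts are positive: a
  part 0 has an empty block, which lies in every block.\<close>

lemma sub_comp_append:
  assumes "0 \<notin> set \<gamma>" "0 \<notin> set \<alpha>" "sum_list \<gamma> = b"
  shows "sub_comp (\<gamma> @ \<alpha>) (b # \<beta>) 0 = \<gamma>"
    and "sub_comp (\<gamma> @ \<alpha>) (b # \<beta>) (Suc i) = sub_comp \<alpha> \<beta> i"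
proof -
  let ?n = "length \<gamma>"
  have upt: "[0..<length (\<gamma> @ \<alpha>)] = [0..<?n] @ map ((+) ?n) [0..<length \<alpha>]"
    by (rule nth_equalityI) (auto simp: nth_append)
  have sub: "sub_comp (\<gamma> @ \<alpha>) \<delta> i =
      map ((!) \<gamma>) (filter (\<lambda>k. block \<gamma> k \<subseteq> block \<delta> i) [0..<?n]) @
      map ((!) \<alpha>) (filter (\<lambda>k. (+) b ` block \<alpha> k \<subseteq> block \<delta> i) [0..<length \<alpha>])" for \<delta> i
  proof -
    have "filter (\<lambda>k. block (\<gamma> @ \<alpha>) k \<subseteq> block \<delta> i) [0..<?n] =
      filter (\<lambda>k. block \<gamma> k \<subseteq> block \<delta> i) [0..<?n]"
      by (rule filter_cong) (simp_all add: block_append_left)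
    then show ?thesis
      unfolding sub_comp_eq_filter upt using assms(3)
      by (simp add: filter_map o_def block_append_right nth_append)
  qed
  have b0: "block (b # \<beta>) 0 = {1..b}" by (simp add: block_def)
  have "filter (\<lambda>k. block \<gamma> k \<subseteq> block (b # \<beta>) 0) [0..<?n] = [0..<?n]"
    using block_subset[of \<gamma>] assms by (simp add: b0 filter_id_conv)
  moreover have "filter (\<lambda>k. (+) b ` block \<alpha> k \<subseteq> block (b # \<beta>) 0) [0..<length \<alpha>] = []"
  proof -
    have "\<not> (+) b ` block \<alpha> k \<subseteq> {1..b}" if "k < length \<alpha>" for k
      using block_nonempty[OF assms(2) that] block_subset[of \<alpha> k] by fastforce
    then show ?thesis by (simp add: b0 filter_empty_conv)
  qed
  ultimately show "sub_comp (\<gamma> @ \<alpha>) (b # \<beta>) 0 = \<gamma>" unfolding sub by (simp add: map_nth)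
  have "filter (\<lambda>k. block \<gamma> k \<subseteq> block (b # \<beta>) (Suc i)) [0..<?n] = []"
  proof -
    have "\<not> block \<gamma> k \<subseteq> (+) b ` block \<beta> i" if "k < length \<gamma>" for k
      using block_nonempty[OF assms(1) that] block_subset[of \<gamma> k] block_subset[of \<beta> i] assms(3)
      by fastforce
    then show ?thesis by (simp add: block_Cons_Suc filter_empty_conv)
  qed
  moreover have "(+) b ` block \<alpha> k \<subseteq> (+) b ` block \<beta> i \<longleftrightarrow> block \<alpha> k \<subseteq> block \<beta> i" for k
    by auto
  ultimately show "sub_comp (\<gamma> @ \<alpha>) (b # \<beta>) (Suc i) = sub_comp \<alpha> \<beta> i"
    unfolding sub by (simp add: block_Cons_Suc sub_comp_eq_filter)
qed

text \<open>Multiplicativity over the blocks of the coarser composition, so that 1/pi can be summed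
  one coarse block at a time.\<close>

lemma pi_pair_append:
  assumes "0 \<notin> set \<gamma>" "0 \<notin> set \<alpha>" "sum_list \<gamma> = b"
  shows "pi_pair (\<gamma> @ \<alpha>) (b # \<beta>) = pi_comp \<gamma> * pi_pair \<alpha> \<beta>"
  unfolding pi_pair_def length_Cons prod.lessThan_Suc_shift
  by (simp add: sub_comp_append[OF assms])

lemma pi_comp_snoc: "pi_comp (\<gamma> @ [g]) = pi_comp \<gamma> * (sum_list \<gamma> + g)"
  by (simp add: pi_comp_def)

lemma comps_snoc_bij:
  assumes "m > 0"
  shows "bij_betw (\<lambda>(g, \<gamma>). \<gamma> @ [g]) (SIGMA g:{1..m}. comps (m - g)) (comps m)"
proof (rule bij_betwI')
  show "\<exists>x\<in>SIGMA g:{1..m}. comps (m - g). y = (case x of (g, \<gamma>) \<Rightarrow> \<gamma> @ [g])" if "y \<in> comps m" for y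
    using that assms by (cases y rule: rev_cases) (fastforce simp: comps_def)+
qed (auto simp: comps_def)

section \<open>Ordered set partitions of a poset\<close>

text \<open>The order ideals of X. They are the possible unions of the first few blocks of an
  ordered partition.\<close>

definition initial :: "('a \<times> 'a) set \<Rightarrow> 'a set \<Rightarrow> 'a set set" where
  "initial r X = {Y. Y \<subseteq> X \<and> (\<forall>y\<in>Y. \<forall>x\<in>X. (x, y) \<in> r \<longrightarrow> x \<in> Y)}"

text \<open>Ordered set partitions with prescribed block sizes, where \<open>F Y\<close> is the set of admissible first blocks
  when the elements of \<open>Y\<close> remain.\<close>

primrec chains :: "('a set \<Rightarrow> 'a set set) \<Rightarrow> nat list \<Rightarrow> 'a set \<Rightarrow> nat" where
  "chains F [] X = (if X = {} then 1 else 0)"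
| "chains F (g # \<gamma>) X = (\<Sum>Z | Z \<in> F X \<and> card Z = g. chains F \<gamma> (X - Z))"

text \<open>Weakly order-preserving maps, encoded by their chains of initial sets; only meaningful when
  \<open>card X\<close> is the sum of the list.\<close>

primrec weak_chains :: "('a \<times> 'a) set \<Rightarrow> nat list \<Rightarrow> 'a set \<Rightarrow> nat" where
  "weak_chains r [] X = 1"
| "weak_chains r (b # \<beta>) X =
     (\<Sum>Y | Y \<in> initial r X \<and> card Y = sum_list \<beta>. weak_chains r \<beta> Y)"

text \<open>The possible lowest colour classes of a strictly order-preserving map. The empty set is
  excluded because compositions have positive parts.\<close>

definition minimal_sets :: "('a \<times> 'a) set \<Rightarrow> 'a set \<Rightarrow> 'a set set" where
  "minimal_sets r X = {Z. Z \<subseteq> X \<and> Z \<noteq> {} \<and> (\<forall>z\<in>Z. \<forall>x\<in>X. (x, z) \<notin> r)}"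

definition down_set :: "('a \<times> 'a) set \<Rightarrow> 'a set \<Rightarrow> 'a \<Rightarrow> 'a set" where
  "down_set r X x = {y \<in> X. y = x \<or> (y, x) \<in> r}"

definition down_sets :: "('a \<times> 'a) set \<Rightarrow> 'a set \<Rightarrow> 'a set set" where
  "down_sets r X = down_set r X ` X"

lemma finite_initial [simp]: "finite X \<Longrightarrow> finite (initial r X)"
  by (rule finite_subset[of _ "Pow X"]) (auto simp: initial_def)

lemma finite_minimal_sets [simp]: "finite X \<Longrightarrow> finite (minimal_sets r X)"
  by (rule finite_subset[of _ "Pow X"]) (auto simp: minimal_sets_def)

text \<open>What the two block families share. By \<open>initial_iff\<close>, whether Z may come
  first can be decided inside any initial set containing Z; so the first few blocks of a partition
  of X form an admissible partition of their union.\<close>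

locale block_rule =
  fixes r :: "('a \<times> 'a) set" and F :: "'a set \<Rightarrow> 'a set set"
  assumes initial: "Z \<in> F X \<Longrightarrow> Z \<in> initial r X"
    and initial_iff: "Y \<in> initial r X \<Longrightarrow> Z \<subseteq> Y \<Longrightarrow> Z \<in> F Y \<longleftrightarrow> Z \<in> F X"
begin

lemma finite_blocks [simp]: "finite X \<Longrightarrow> finite (F X)"
  using initial by (intro finite_subset[OF _ finite_initial[of X r]]) auto

text \<open>Cut the sequence of blocks after the first \<open>length \<gamma>\<close> of them: their
  union Y is initial, and the two halves are independent partitions of Y and of
  \<open>X - Y\<close>.\<close>

lemma chains_append:
  assumes "finite X"
  shows "chains F (\<gamma> @ \<alpha>) X =
    (\<Sum>Y | Y \<in> initial r X \<and> card Y = sum_list \<gamma>. chains F \<gamma> Y * chains F \<alpha> (X - Y))"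
  using assms
proof (induction \<gamma> arbitrary: X)
  case Nil
  have "{Y. Y \<in> initial r X \<and> card Y = sum_list []} = {{}}"
    using Nil by (auto simp: initial_def dest: finite_subset)
  then show ?case by simp
next
  case (Cons g \<gamma>)
  let ?A = "SIGMA Z:{Z. Z \<in> F X \<and> card Z = g}. {W. W \<in> initial r (X - Z) \<and> card W = sum_list \<gamma>}"
  let ?B = "SIGMA Y:{Y. Y \<in> initial r X \<and> card Y = sum_list (g # \<gamma>)}. {Z. Z \<in> F Y \<and> card Z = g}"
  have fin: "finite Z" if "Z \<subseteq> X" for Z using that Cons.prems finite_subset by auto
  have *: "Y \<subseteq> X" if "Y \<in> initial r X" for X Y using that by (auto simp: initial_def)
  have "chains F ((g # \<gamma>) @ \<alpha>) X = (\<Sum>Z | Z \<in> F X \<and> card Z = g.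
      \<Sum>W | W \<in> initial r (X - Z) \<and> card W = sum_list \<gamma>.
        chains F \<gamma> W * chains F \<alpha> (X - Z - W))"
    using Cons by simp
  also have "\<dots> = (\<Sum>(Z, W)\<in>?A. chains F \<gamma> W * chains F \<alpha> (X - Z - W))"
    using Cons.prems by (intro sum.Sigma) auto
  also have "\<dots> = (\<Sum>(Y, Z)\<in>?B. chains F \<gamma> (Y - Z) * chains F \<alpha> (X - Y))"
  \<comment> \<open>Z is the first block and W the union of the other blocks of the first half; the
    pair is re-encoded by the union of the whole first half together with Z.\<close>
  proof (rule sum.reindex_bij_witness[where i = "\<lambda>(Y, Z). (Z, Y - Z)" and j = "\<lambda>(Z, W). (Z \<union> W, Z)"])
    fix a assume "a \<in> ?A"
    then obtain Z W where a: "a = (Z, W)" "Z \<in> F X" "card Z = g"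
      "W \<in> initial r (X - Z)" "card W = sum_list \<gamma>" by auto
    note Z = *[OF initial[OF a(2)]] and W = *[OF a(4)]
    have disj: "Z \<inter> W = {}" using W by auto
    have U: "Z \<union> W \<in> initial r X"
      using initial[OF a(2)] a(4) unfolding initial_def by blast
    have "Z \<in> F (Z \<union> W)" using initial_iff[OF U, of Z] a by auto
    moreover have "finite Z" "finite W" using Z W by (auto intro: fin)
    then have "card (Z \<union> W) = sum_list (g # \<gamma>)" using disj a by (simp add: card_Un_disjoint)
    ultimately show "(case a of (Z, W) \<Rightarrow> (Z \<union> W, Z)) \<in> ?B" using a U by auto
    show "(case (case a of (Z, W) \<Rightarrow> (Z \<union> W, Z)) of (Y, Z) \<Rightarrow> (Z, Y - Z)) = a"
      using a disj by auto
    have "Z \<union> W - Z = W" "X - (Z \<union> W) = X - Z - W" using disj by auto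
    then show "(case (case a of (Z, W) \<Rightarrow> (Z \<union> W, Z)) of
        (Y, Z) \<Rightarrow> chains F \<gamma> (Y - Z) * chains F \<alpha> (X - Y)) =
        (case a of (Z, W) \<Rightarrow> chains F \<gamma> W * chains F \<alpha> (X - Z - W))"
      using a by simp
  next
    fix b assume "b \<in> ?B"
    then obtain Y Z where b: "b = (Y, Z)" "Y \<in> initial r X" "card Y = g + sum_list \<gamma>"
      "Z \<in> F Y" "card Z = g" by auto
    note Y = *[OF b(2)] and Z = *[OF initial[OF b(4)]]
    have "Z \<in> F X" using initial_iff[OF b(2) Z] b by auto
    moreover have "Y - Z \<in> initial r (X - Z)"
      using b(2) unfolding initial_def by blast
    moreover have "card (Y - Z) = sum_list \<gamma>"
      using b fin[OF Y] Z by (simp add: card_Diff_subset finite_subset)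
    ultimately show "(case b of (Y, Z) \<Rightarrow> (Z, Y - Z)) \<in> ?A" using b by auto
    show "(case (case b of (Y, Z) \<Rightarrow> (Z, Y - Z)) of (Z, W) \<Rightarrow> (Z \<union> W, Z)) = b"
      using b Z by auto
  qed
  also have "\<dots> = (\<Sum>Y | Y \<in> initial r X \<and> card Y = sum_list (g # \<gamma>).
      \<Sum>Z | Z \<in> F Y \<and> card Z = g. chains F \<gamma> (Y - Z) * chains F \<alpha> (X - Y))"
    using Cons.prems fin * by (intro sum.Sigma[symmetric]) auto
  also have "\<dots> = (\<Sum>Y | Y \<in> initial r X \<and> card Y = sum_list (g # \<gamma>).
      chains F (g # \<gamma>) Y * chains F \<alpha> (X - Y))"
    by (simp add: sum_distrib_right)
  finally show ?case .
qed

text \<open>As \<open>chains\<close> is fed reversed compositions, the first coarse block b takes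
  the top of X: if Y is the part below, the refinement \<open>\<gamma> @ \<alpha>\<close> puts
  \<open>rev \<alpha>\<close> on Y and \<open>rev \<gamma>\<close> on \<open>X - Y\<close>. Summing
  over \<gamma> gives 1 by \<open>total\<close>, and what remains is a sum over initial sets Y that
  no longer involves F or the weights.\<close>

lemma sum_refinements_eq_weak_chains:
  fixes u :: "nat list \<Rightarrow> 'b :: comm_ring_1"
  assumes total: "\<And>Y. finite Y \<Longrightarrow> (\<Sum>\<gamma>\<in>comps (card Y). u \<gamma> * of_nat (chains F (rev \<gamma>) Y)) = 1"
    and U_Nil: "U [] [] = 1"
    and U_append: "\<And>\<gamma> \<alpha> b \<beta>. \<gamma> \<in> comps b \<Longrightarrow> 0 \<notin> set \<alpha> \<Longrightarrow> U (\<gamma> @ \<alpha>) (b # \<beta>) = u \<gamma> * U \<alpha> \<beta>"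
    and "finite X" "0 \<notin> set \<beta>" "card X = sum_list \<beta>"
  shows "(\<Sum>\<alpha> | \<alpha> \<in> comps (sum_list \<beta>) \<and> psums \<beta> \<subseteq> psums \<alpha>. U \<alpha> \<beta> * of_nat (chains F (rev \<alpha>) X)) =
    of_nat (weak_chains r \<beta> X)"
  using assms(4-)
proof (induction \<beta> arbitrary: X)
  case Nil
  have "{\<alpha>. \<alpha> \<in> comps (sum_list []) \<and> psums [] \<subseteq> psums \<alpha>} = {[]}" by auto
  then show ?case using Nil U_Nil by simp
next
  case (Cons b \<beta>)
  let ?R = "{\<alpha>. \<alpha> \<in> comps (sum_list \<beta>) \<and> psums \<beta> \<subseteq> psums \<alpha>}"
  let ?Y = "{Y. Y \<in> initial r X \<and> card Y = sum_list \<beta>}"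
  have "b > 0" using Cons.prems by (cases b) auto
  have "(\<Sum>\<alpha> | \<alpha> \<in> comps (sum_list (b # \<beta>)) \<and> psums (b # \<beta>) \<subseteq> psums \<alpha>.
      U \<alpha> (b # \<beta>) * of_nat (chains F (rev \<alpha>) X)) =
    (\<Sum>\<gamma>\<in>comps b. \<Sum>\<alpha>\<in>?R. U (\<gamma> @ \<alpha>) (b # \<beta>) * of_nat (chains F (rev (\<gamma> @ \<alpha>)) X))"
    by (rule sum_refinements_Cons[OF \<open>b > 0\<close>])
  also have "\<dots> = (\<Sum>\<gamma>\<in>comps b. \<Sum>\<alpha>\<in>?R. \<Sum>Y\<in>?Y.
      (u \<gamma> * of_nat (chains F (rev \<gamma>) (X - Y))) * (U \<alpha> \<beta> * of_nat (chains F (rev \<alpha>) Y)))"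
  proof (intro sum.cong refl)
    fix \<gamma> \<alpha> assume "\<gamma> \<in> comps b" "\<alpha> \<in> ?R"
    then have "sum_list (rev \<alpha>) = sum_list \<beta>" "U (\<gamma> @ \<alpha>) (b # \<beta>) = u \<gamma> * U \<alpha> \<beta>"
      by (auto simp: comps_def U_append)
    then show "U (\<gamma> @ \<alpha>) (b # \<beta>) * of_nat (chains F (rev (\<gamma> @ \<alpha>)) X) = (\<Sum>Y\<in>?Y.
      (u \<gamma> * of_nat (chains F (rev \<gamma>) (X - Y))) * (U \<alpha> \<beta> * of_nat (chains F (rev \<alpha>) Y)))"
      using Cons.prems(1) by (simp add: chains_append sum_distrib_left mult_ac)
  qed
  also have "\<dots> = (\<Sum>\<gamma>\<in>comps b. \<Sum>Y\<in>?Y. \<Sum>\<alpha>\<in>?R.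
      (u \<gamma> * of_nat (chains F (rev \<gamma>) (X - Y))) * (U \<alpha> \<beta> * of_nat (chains F (rev \<alpha>) Y)))"
    by (intro sum.cong refl sum.swap)
  also have "\<dots> = (\<Sum>Y\<in>?Y. (\<Sum>\<gamma>\<in>comps b. u \<gamma> * of_nat (chains F (rev \<gamma>) (X - Y))) *
      (\<Sum>\<alpha>\<in>?R. U \<alpha> \<beta> * of_nat (chains F (rev \<alpha>) Y)))"
    unfolding sum_product by (rule sum.swap)
  also have "\<dots> = (\<Sum>Y\<in>?Y. of_nat (weak_chains r \<beta> Y))"
  proof (rule sum.cong[OF refl])
    fix Y assume Y: "Y \<in> ?Y"
    then have "Y \<subseteq> X" by (auto simp: initial_def)
    then have fin: "finite Y" using Cons.prems finite_subset by auto
    have "card (X - Y) = b" using Cons.prems Y fin \<open>Y \<subseteq> X\<close> by (simp add: card_Diff_subset)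
    then have "(\<Sum>\<gamma>\<in>comps b. u \<gamma> * of_nat (chains F (rev \<gamma>) (X - Y))) = 1"
      using total[of "X - Y"] Cons.prems by simp
    moreover have "(\<Sum>\<alpha>\<in>?R. U \<alpha> \<beta> * of_nat (chains F (rev \<alpha>) Y)) = of_nat (weak_chains r \<beta> Y)"
      using Cons.IH[OF fin] Cons.prems Y by simp
    ultimately show "(\<Sum>\<gamma>\<in>comps b. u \<gamma> * of_nat (chains F (rev \<gamma>) (X - Y))) *
      (\<Sum>\<alpha>\<in>?R. U \<alpha> \<beta> * of_nat (chains F (rev \<alpha>) Y)) = of_nat (weak_chains r \<beta> Y)" by simp
  qed
  finally show ?case by simp
qed

text \<open>Splits off the last part of \<gamma>, which is the size of the first block of
  \<open>rev \<gamma>\<close>. The condition on u is confined to compositions of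
  \<open>card X\<close>, so that v may depend on X.\<close>

lemma sum_comps_chains:
  fixes u :: "nat list \<Rightarrow> 'b :: comm_ring_1"
  assumes "finite X" "X \<noteq> {}" "{} \<notin> F X"
    and u: "\<And>g \<gamma>. g > 0 \<Longrightarrow> g + sum_list \<gamma> = card X \<Longrightarrow> u (\<gamma> @ [g]) = v g * u \<gamma>"
  shows "(\<Sum>\<gamma>\<in>comps (card X). u \<gamma> * of_nat (chains F (rev \<gamma>) X)) =
    (\<Sum>Z\<in>F X. v (card Z) * (\<Sum>\<gamma>\<in>comps (card (X - Z)). u \<gamma> * of_nat (chains F (rev \<gamma>) (X - Z))))"
proof -
  let ?m = "card X"
  have "?m > 0" using assms by (simp add: card_gt_0_iff)
  have Z: "Z \<subseteq> X" "finite Z" "card Z \<in> {1..?m}" "card (X - Z) = ?m - card Z" if "Z \<in> F X" for Z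
  proof -
    show 1: "Z \<subseteq> X" using initial[OF that] by (auto simp: initial_def)
    show 2: "finite Z" using 1 assms(1) by (rule finite_subset)
    show "card Z \<in> {1..?m}" using 1 2 that assms card_mono[of X Z]
      by (cases "Z = {}") (auto simp: Suc_le_eq card_gt_0_iff)
    show "card (X - Z) = ?m - card Z" using 1 2 by (simp add: card_Diff_subset)
  qed
  define H where "H = (\<lambda>\<gamma>. u \<gamma> * of_nat (chains F (rev \<gamma>) X))"
  have "sum H (comps ?m) = (\<Sum>g\<in>{1..?m}. \<Sum>\<gamma>\<in>comps (?m - g). H (\<gamma> @ [g]))"
    using sum.reindex_bij_betw[OF comps_snoc_bij[OF \<open>?m > 0\<close>], of H]
    by (simp add: sum.Sigma case_prod_unfold)
  then have "(\<Sum>\<gamma>\<in>comps ?m. u \<gamma> * of_nat (chains F (rev \<gamma>) X)) =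
    (\<Sum>g\<in>{1..?m}. \<Sum>\<gamma>\<in>comps (?m - g). u (\<gamma> @ [g]) * of_nat (chains F (rev (\<gamma> @ [g])) X))"
    by (simp only: H_def)
  also have "\<dots> = (\<Sum>g\<in>{1..?m}. \<Sum>\<gamma>\<in>comps (?m - g). \<Sum>Z | Z \<in> F X \<and> card Z = g.
      v (card Z) * (u \<gamma> * of_nat (chains F (rev \<gamma>) (X - Z))))"
  proof (intro sum.cong refl)
    fix g \<gamma> assume "g \<in> {1..?m}" "\<gamma> \<in> comps (?m - g)"
    then have "u (\<gamma> @ [g]) = v g * u \<gamma>" using u[of g \<gamma>] by (auto simp: comps_def)
    then show "u (\<gamma> @ [g]) * of_nat (chains F (rev (\<gamma> @ [g])) X) =
      (\<Sum>Z | Z \<in> F X \<and> card Z = g. v (card Z) * (u \<gamma> * of_nat (chains F (rev \<gamma>) (X - Z))))"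
      by (simp add: sum_distrib_left mult_ac)
  qed
  also have "\<dots> = (\<Sum>g\<in>{1..?m}. \<Sum>Z | Z \<in> F X \<and> card Z = g. \<Sum>\<gamma>\<in>comps (?m - card Z).
      v (card Z) * (u \<gamma> * of_nat (chains F (rev \<gamma>) (X - Z))))"
    by (rule sum.cong[OF refl], subst sum.swap) (auto intro!: sum.cong)
  \<comment> \<open>Admissible blocks are nonempty, so grouping them by sizes from 1 to
    \<open>?m\<close> misses none.\<close>
  also have "\<dots> = (\<Sum>Z\<in>F X. \<Sum>\<gamma>\<in>comps (?m - card Z).
      v (card Z) * (u \<gamma> * of_nat (chains F (rev \<gamma>) (X - Z))))"
    using Z(3) assms(1) by (intro sum.group) auto
  also have "\<dots> = (\<Sum>Z\<in>F X. v (card Z) *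
      (\<Sum>\<gamma>\<in>comps (card (X - Z)). u \<gamma> * of_nat (chains F (rev \<gamma>) (X - Z))))"
    using Z(4) by (simp add: sum_distrib_left)
  finally show ?thesis .
qed

end

section \<open>The two identities for a finite strict order\<close>

locale strict_order =
  fixes r :: "('a \<times> 'a) set"
  assumes trans_r: "trans r" and irrefl_r: "irrefl r"
begin

text \<open>An initial set contains everything in X below its members, so being minimal in Y and
  being minimal in X coincide on Y.\<close>

lemma block_rule_minimal_sets: "block_rule r (minimal_sets r)"
proof
  show "Z \<in> minimal_sets r X \<Longrightarrow> Z \<in> initial r X" for Z X
    by (auto simp: minimal_sets_def initial_def)
  show "Y \<in> initial r X \<Longrightarrow> Z \<subseteq> Y \<Longrightarrow> Z \<in> minimal_sets r Y \<longleftrightarrow> Z \<in> minimal_sets r X" for X Y Z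
    unfolding minimal_sets_def initial_def by blast
qed

lemma in_down_set: "x \<in> X \<Longrightarrow> x \<in> down_set r X x"
  by (auto simp: down_set_def)

text \<open>Transitivity makes principal down-sets initial. A down-set contained in an initial Y
  contains its own generator, and it is the same whether formed in Y or in X.\<close>

lemma block_rule_down_sets: "block_rule r (down_sets r)"
proof
  show "Z \<in> down_sets r X \<Longrightarrow> Z \<in> initial r X" for Z X
    using trans_r unfolding down_sets_def initial_def down_set_def trans_def by blast
  fix X Y Z assume Y: "Y \<in> initial r X" and ZY: "Z \<subseteq> Y"
  have eq: "down_set r Y x = down_set r X x" if "x \<in> Y" for x
    using Y that by (auto simp: initial_def down_set_def)
  show "Z \<in> down_sets r Y \<longleftrightarrow> Z \<in> down_sets r X"
  proof
    assume "Z \<in> down_sets r Y"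
    then show "Z \<in> down_sets r X" using eq Y by (auto simp: down_sets_def initial_def)
  next
    assume "Z \<in> down_sets r X"
    then obtain x where "x \<in> X" "Z = down_set r X x" by (auto simp: down_sets_def)
    then have "x \<in> Y" using ZY in_down_set by auto
    then show "Z \<in> down_sets r Y" using eq \<open>Z = down_set r X x\<close> by (auto simp: down_sets_def)
  qed
qed

text \<open>Distinct generators of one down-set would lie strictly below each other. Hence a finite
  X has exactly |X| principal down-sets.\<close>

lemma inj_on_down_set: "inj_on (down_set r X) X"
proof (rule inj_onI)
  fix x y assume *: "x \<in> X" "y \<in> X" "down_set r X x = down_set r X y"
  then have "x \<in> down_set r X y" "y \<in> down_set r X x" using in_down_set by blast+
  then show "x = y" using trans_r irrefl_r by (auto simp: down_set_def irrefl_def dest: transD)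
qed

lemma exists_minimal:
  assumes "finite X" "X \<noteq> {}"
  shows "\<exists>z\<in>X. \<forall>x\<in>X. (x, z) \<notin> r"
proof -
  have "acyclic r" using trans_r irrefl_r by (simp add: acyclic_irrefl)
  then have "acyclic (r \<inter> X \<times> X)" by (rule acyclic_subset) auto
  then have "wf (r \<inter> X \<times> X)" using assms by (intro finite_acyclic_wf) auto
  moreover obtain x where "x \<in> X" using assms(2) by auto
  ultimately obtain z where "z \<in> X" "\<And>y. (y, z) \<in> r \<inter> X \<times> X \<Longrightarrow> y \<notin> X"
    by (rule wfE_min) blast
  then have "z \<in> X" "(x, z) \<notin> r" if "x \<in> X" for x using that by blast+
  with \<open>x \<in> X\<close> show ?thesis by blast
qed

lemma sum_down_set_chains:
  assumes "finite X"
  shows "(\<Sum>\<gamma>\<in>comps (card X). inverse (of_nat (pi_comp \<gamma>)) * of_nat (chains (down_sets r) (rev \<gamma>) X)) =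
    (1 :: 'b :: field_char_0)"
  using assms
proof (induction "card X" arbitrary: X rule: less_induct)
  case less
  interpret block_rule r "down_sets r" by (rule block_rule_down_sets)
  let ?t = "\<lambda>X. \<Sum>\<gamma>\<in>comps (card X). inverse (of_nat (pi_comp \<gamma>)) *
     of_nat (chains (down_sets r) (rev \<gamma>) X) :: 'b"
  show ?case
  proof (cases "X = {}")
    case True
    then show ?thesis by (simp add: pi_comp_def)
  next
    case False
    have "?t X = (\<Sum>Z\<in>down_sets r X. inverse (of_nat (card X)) * ?t (X - Z))"
    \<comment> \<open>The weight does not depend on the size of the removed block: the last factor
      of \<open>pi_comp (\<gamma> @ [g])\<close> is the total, here \<open>card X\<close>.\<close>
    proof (rule sum_comps_chains[where v = "\<lambda>_. inverse (of_nat (card X))"])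
      show "{} \<notin> down_sets r X" using in_down_set by (fastforce simp: down_sets_def)
    qed (use less.prems False in \<open>auto simp: pi_comp_snoc add.commute\<close>)
    also have "\<dots> = (\<Sum>Z\<in>down_sets r X. inverse (of_nat (card X)))"
    proof (rule sum.cong[OF refl])
      fix Z assume "Z \<in> down_sets r X"
      then obtain x where "x \<in> X" "Z = down_set r X x" by (auto simp: down_sets_def)
      then have "X - Z \<subset> X" using in_down_set[of x X] by auto
      then have "card (X - Z) < card X" using less.prems by (rule psubset_card_mono[rotated])
      then have "?t (X - Z) = 1" by (rule less.hyps) (use less.prems in simp)
      then show "inverse (of_nat (card X)) * ?t (X - Z) = inverse (of_nat (card X))"
        by (simp only: mult_1_right)
    qed
    also have "\<dots> = 1"
      using less.prems False by (simp add: down_sets_def card_image[OF inj_on_down_set])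
    finally show ?thesis .
  qed
qed

text \<open>The signed sum over all subsets of the nonempty set of minimal elements vanishes;
  dropping the empty set and flipping the sign leaves 1.\<close>

lemma sum_minimal_sets:
  assumes "finite X" "X \<noteq> {}"
  shows "(\<Sum>Z\<in>minimal_sets r X. (-1) ^ (card Z + 1)) = (1 :: 'b :: comm_ring_1)"
proof -
  define M where "M = {z \<in> X. \<forall>x\<in>X. (x, z) \<notin> r}"
  have M: "finite M" "M \<noteq> {}" using assms exists_minimal by (auto simp: M_def)
  have "(\<Sum>Z\<in>Pow M. (-1) ^ card Z) = (0 :: 'b)"
  proof (rule sum_alternating_cancels)
    show "finite (Pow M)" using M by simp
    show "card {x \<in> Pow M. even (card x)} = card {x \<in> Pow M. odd (card x)}"
      using card_subsupersets_even_odd[of M "{}"] M by auto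
  qed
  moreover have "minimal_sets r X = Pow M - {{}}" by (auto simp: minimal_sets_def M_def)
  ultimately show ?thesis using M by (simp add: sum_diff1 sum_negf)
qed

text \<open>The exponent is the sum of g + 1 over the parts g, so the sign is a product of one sign
  per block.\<close>

lemma sum_minimal_set_chains:
  assumes "finite X"
  shows "(\<Sum>\<gamma>\<in>comps (card X). (-1) ^ (sum_list \<gamma> + length \<gamma>) * of_nat (chains (minimal_sets r) (rev \<gamma>) X)) =
    (1 :: 'b :: comm_ring_1)"
  using assms
proof (induction "card X" arbitrary: X rule: less_induct)
  case less
  interpret block_rule r "minimal_sets r" by (rule block_rule_minimal_sets)
  let ?t = "\<lambda>X. \<Sum>\<gamma>\<in>comps (card X). (-1) ^ (sum_list \<gamma> + length \<gamma>) *
     of_nat (chains (minimal_sets r) (rev \<gamma>) X) :: 'b"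
  show ?case
  proof (cases "X = {}")
    case False
    have "?t X = (\<Sum>Z\<in>minimal_sets r X. (-1) ^ (card Z + 1) * ?t (X - Z))"
      by (rule sum_comps_chains)
        (use less.prems False in \<open>auto simp: power_add minimal_sets_def\<close>)
    also have "\<dots> = (\<Sum>Z\<in>minimal_sets r X. (-1) ^ (card Z + 1))"
    proof (rule sum.cong[OF refl])
      fix Z assume "Z \<in> minimal_sets r X"
      then have "X - Z \<subset> X" by (auto simp: minimal_sets_def)
      then have "card (X - Z) < card X" using less.prems by (rule psubset_card_mono[rotated])
      then have "?t (X - Z) = 1" by (rule less.hyps) (use less.prems in simp)
      then show "(-1) ^ (card Z + 1) * ?t (X - Z) = (-1) ^ (card Z + 1)"
        by (simp only: mult_1_right)
    qed
    also have "\<dots> = 1" using less.prems False by (rule sum_minimal_sets)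
    finally show ?thesis .
  qed simp
qed

lemma chains_reciprocity:
  assumes "finite X" "\<beta> \<in> comps (card X)"
  shows "(\<Sum>\<alpha> | \<alpha> \<in> comps (card X) \<and> comp_le \<alpha> \<beta>.
      (-1) ^ (card X + length \<alpha>) * of_nat (chains (minimal_sets r) (rev \<alpha>) X)) =
    (\<Sum>\<alpha> | \<alpha> \<in> comps (card X) \<and> comp_le \<alpha> \<beta>.
      inverse (of_nat (pi_pair \<alpha> \<beta>)) * of_nat (chains (down_sets r) (rev \<alpha>) X) :: 'b :: field_char_0)"
proof -
  have \<beta>: "0 \<notin> set \<beta>" "card X = sum_list \<beta>" using assms by (auto simp: comps_def)
  have pi_pair_Nil: "pi_pair [] [] = 1" by (simp add: pi_pair_def)
  have R: "{\<alpha>. \<alpha> \<in> comps (card X) \<and> comp_le \<alpha> \<beta>} =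
      {\<alpha>. \<alpha> \<in> comps (sum_list \<beta>) \<and> psums \<beta> \<subseteq> psums \<alpha>}"
    using assms comp_le_iff_psums \<beta> by auto
  have "(\<Sum>\<alpha> | \<alpha> \<in> comps (card X) \<and> comp_le \<alpha> \<beta>.
      (-1) ^ (card X + length \<alpha>) * of_nat (chains (minimal_sets r) (rev \<alpha>) X)) =
    (\<Sum>\<alpha> | \<alpha> \<in> comps (sum_list \<beta>) \<and> psums \<beta> \<subseteq> psums \<alpha>.
      (-1) ^ (sum_list \<alpha> + length \<alpha>) * of_nat (chains (minimal_sets r) (rev \<alpha>) X) :: 'b)"
    unfolding R by (rule sum.cong) (auto simp: comps_def \<beta>)
  \<comment> \<open>The sign depends on \<alpha> alone, while 1/pi below also depends on \<beta>,
    whose blocks tell where the partial sums restart; hence the two-argument weight U.\<close>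
  also have "\<dots> = of_nat (weak_chains r \<beta> X)"
    by (rule block_rule.sum_refinements_eq_weak_chains[OF block_rule_minimal_sets,
          where u = "\<lambda>\<gamma>. (-1) ^ (sum_list \<gamma> + length \<gamma>)" and U = "\<lambda>\<alpha> \<beta>. (-1) ^ (sum_list \<alpha> + length \<alpha>)"])
      (use assms \<beta> sum_minimal_set_chains in \<open>auto simp: power_add comps_def mult_ac\<close>)
  also have "\<dots> = (\<Sum>\<alpha> | \<alpha> \<in> comps (sum_list \<beta>) \<and> psums \<beta> \<subseteq> psums \<alpha>.
      inverse (of_nat (pi_pair \<alpha> \<beta>)) * of_nat (chains (down_sets r) (rev \<alpha>) X) :: 'b)"
    by (rule block_rule.sum_refinements_eq_weak_chains[OF block_rule_down_sets,
          where u = "\<lambda>\<gamma>. inverse (of_nat (pi_comp \<gamma>))" and U = "\<lambda>\<alpha> \<beta>. inverse (of_nat (pi_pair \<alpha> \<beta>))", symmetric])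
      (use assms \<beta> sum_down_set_chains in \<open>auto simp: comps_def pi_pair_append pi_pair_Nil\<close>)
  finally show ?thesis unfolding R .
qed

end

section \<open>Coefficients of the series\<close>

text \<open>Exactly the exponent vectors of colorings (\<open>is_content_content\<close>,
  \<open>weak_coloring_in\<close>); all other coefficients of the series vanish.\<close>

definition is_content :: "nat \<Rightarrow> (nat \<Rightarrow> nat) \<Rightarrow> bool" where
  "is_content n e \<longleftrightarrow> finite {c. e c \<noteq> 0} \<and> e 0 = 0 \<and> (\<Sum>c | e c \<noteq> 0. e c) = n"

text \<open>The composition \<beta> for which x^e is a monomial of M_\<beta>.\<close>

definition parts :: "(nat \<Rightarrow> nat) \<Rightarrow> nat list" where
  "parts e = map e (sorted_list_of_set {c. e c \<noteq> 0})"

lemma parts_in_comps: "is_content n e \<Longrightarrow> parts e \<in> comps n"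
  by (auto simp: is_content_def comps_def parts_def sum_list_distinct_conv_sum_set)

lemma is_content_content:
  assumes "\<kappa> \<in> colorings n"
  shows "is_content n (content n \<kappa>)"
proof -
  have supp: "{c. content n \<kappa> c \<noteq> 0} = \<kappa> ` {1..n}" by (auto simp: content_def)
  have "(\<Sum>c\<in>\<kappa> ` {1..n}. content n \<kappa> c) = card {1..n}"
    unfolding content_def card_eq_sum by (rule sum.group) auto
  moreover have "0 \<notin> \<kappa> ` {1..n}" using assms by (auto simp: colorings_def PiE_iff)
  then have "content n \<kappa> 0 = 0" using supp by blast
  ultimately show ?thesis unfolding is_content_def supp by simp
qed

text \<open>Allows an equation of series to be read off composition by composition.\<close>

lemma ex_is_content:
  assumes "\<beta> \<in> comps n"
  shows "\<exists>e. is_content n e \<and> parts e = \<beta>"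
proof -
  \<comment> \<open>\<beta> is placed on the first variables; these start at x_1 whereas list
    positions start at 0.\<close>
  define e where "e c = (if c \<in> {1..length \<beta>} then \<beta> ! (c - 1) else 0)" for c
  have nz: "\<beta> ! k \<noteq> 0" if "k < length \<beta>" for k
    using that in_compsD(1)[OF assms] nth_mem by metis
  have supp: "{c. e c \<noteq> 0} = {1..<Suc (length \<beta>)}" using nz by (auto simp: e_def)
  have "sorted_list_of_set {c. e c \<noteq> 0} = [1..<Suc (length \<beta>)]"
    unfolding supp by (rule sorted_list_of_set_range)
  then have p: "parts e = \<beta>" unfolding parts_def
    by (simp del: upt_Suc, intro nth_equalityI) (auto simp: e_def simp del: upt_Suc)
  have fin: "finite {c. e c \<noteq> 0}" unfolding supp by simp
  then have "(\<Sum>c | e c \<noteq> 0. e c) = sum_list (parts e)"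
    unfolding parts_def by (simp add: sum_list_distinct_conv_sum_set)
  then have "(\<Sum>c | e c \<noteq> 0. e c) = n" using p in_compsD(2)[OF assms] by simp
  with fin have "is_content n e" by (simp add: is_content_def e_def)
  with p show ?thesis by blast
qed

text \<open>Replaces list positions by colours: a colour outside s merely repeats a cumulative sum.
  The extra 0 matters when 0 is in s, since then every colour bound already includes a
  summand.\<close>

lemma psums_map_sorted:
  assumes "sorted_wrt (<) (s :: nat list)"
  shows "psums (map e s) = insert 0 (range (\<lambda>c. \<Sum>x | x \<in> set s \<and> x \<le> c. e x))"
  using assms
proof (induction s)
  case Nil
  then show ?case by auto
next
  case (Cons a s)
  let ?f = "\<lambda>s c. \<Sum>x | x \<in> set s \<and> x \<le> c. e x"
  have less: "\<forall>x\<in>set s. a < x" using Cons.prems by simp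
  have f: "?f (a # s) c = (if a \<le> c then e a + ?f s c else 0)" for c
  proof (cases "a \<le> c")
    case True
    then have "{x. x \<in> set (a # s) \<and> x \<le> c} = insert a {x. x \<in> set s \<and> x \<le> c}" by auto
    moreover have "a \<notin> {x. x \<in> set s \<and> x \<le> c}" using less by auto
    ultimately show ?thesis using True by simp
  next
    case False
    then have empty: "{x. x \<in> set (a # s) \<and> x \<le> c} = {}" using less by auto
    show ?thesis unfolding empty using False by simp
  qed
  have s0: "?f s a = 0"
  proof -
    have empty: "{x. x \<in> set s \<and> x \<le> a} = {}" using less by auto
    show ?thesis unfolding empty by simp
  qed
  have "psums (map e (a # s)) = insert 0 ((+) (e a) ` insert 0 (range (?f s)))"
    using Cons by simp
  also have "\<dots> = insert 0 (range (?f (a # s)))" (is "?L = ?R")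
  proof (intro equalityI subsetI)
    fix x assume "x \<in> ?L"
    then consider "x = 0" | "x = e a" | c where "x = e a + ?f s c" by auto
    then show "x \<in> ?R"
    proof cases
      case 2
      then have "x = ?f (a # s) a" using s0 f[of a] by simp
      then show ?thesis by blast
    next
      case 3
      show ?thesis
      proof (cases "a \<le> c")
        case True
        then have "x = ?f (a # s) c" using 3 f by simp
        then show ?thesis by blast
      next
        case False
        then have empty: "{x. x \<in> set s \<and> x \<le> c} = {}" using less by auto
        have "x = ?f (a # s) a" using 3 s0 f[of a] unfolding empty by simp
        then show ?thesis by blast
      qed
    qed simp
  next
    fix x assume "x \<in> ?R"
    then consider "x = 0" | c where "x = ?f (a # s) c" by blast
    then show "x \<in> ?L"
    proof cases
      case 2
      then show ?thesis unfolding f by auto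
    qed simp
  qed
  finally show ?case .
qed

lemma psums_parts:
  assumes "is_content n e"
  shows "psums (parts e) = range (\<lambda>c. \<Sum>x\<le>c. e x)"
proof -
  let ?S = "{c. e c \<noteq> 0}"
  have fin: "finite ?S" "e 0 = 0" using assms by (auto simp: is_content_def)
  have "(\<Sum>x | x \<in> set (sorted_list_of_set ?S) \<and> x \<le> c. e x) = (\<Sum>x\<le>c. e x)" for c
    using fin by (intro sum.mono_neutral_left) auto
  then have "psums (parts e) = insert 0 (range (\<lambda>c. \<Sum>x\<le>c. e x))"
    unfolding parts_def by (subst psums_map_sorted) (simp_all add: strict_sorted_list_of_set)
  moreover have "0 \<in> range (\<lambda>c. \<Sum>x\<le>c. e x)"
    using fin by (intro image_eqI[of _ _ 0]) auto
  ultimately show ?thesis by (simp only: insert_absorb)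
qed

section \<open>Coefficients of the fundamental quasisymmetric functions\<close>

lemma down_closed_eq_atLeastAtMost:
  assumes "finite D" "0 \<notin> D" "\<And>i j. i \<in> D \<Longrightarrow> 1 \<le> j \<Longrightarrow> j \<le> i \<Longrightarrow> j \<in> D"
  shows "D = {1..card D}"
proof (rule card_subset_eq)
  show "D \<subseteq> {1..card D}"
  proof
    fix i assume i: "i \<in> D"
    then have "{1..i} \<subseteq> D" using assms(3) by auto
    then have "card {1..i} \<le> card D" using assms(1) by (rule card_mono[rotated])
    moreover have "i \<noteq> 0" using i assms(2) by metis
    ultimately show "i \<in> {1..card D}" by simp
  qed
qed auto

context
  fixes n :: nat and e :: "nat \<Rightarrow> nat"
  assumes content: "is_content n e"
begin

abbreviation "psum_upto c \<equiv> \<Sum>x\<le>c. e x"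

abbreviation "weak_colorings \<equiv>
  {j \<in> colorings n. (\<forall>i\<in>{1..<n}. j i \<le> j (Suc i)) \<and> content n j = e}"

lemma psum_upto_mono: "c \<le> d \<Longrightarrow> psum_upto c \<le> psum_upto d"
  by (rule sum_mono2) auto

lemma psum_upto_le: "psum_upto c \<le> n"
  using psums_parts[OF content] psums_le[of "psum_upto c" "parts e"] parts_in_comps[OF content]
  by (auto simp: comps_def)

lemma ex_le_psum_upto: "i \<le> n \<Longrightarrow> \<exists>c. i \<le> psum_upto c"
proof -
  assume "i \<le> n"
  moreover have "n \<in> range psum_upto"
    using psums_parts[OF content] sum_list_in_psums[of "parts e"] in_compsD[OF parts_in_comps[OF content]]
    by auto
  ultimately show ?thesis by auto
qed

text \<open>Since j is weakly increasing, the vertices of colour at most c form an initial segment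
  of [n], and the content fixes its length as a cumulative sum. This equivalence determines j on
  [n].\<close>

lemma weak_coloring_le_iff:
  assumes j: "j \<in> weak_colorings" and i: "i \<in> {1..n}"
  shows "j i \<le> c \<longleftrightarrow> i \<le> psum_upto c"
proof -
  let ?D = "{i \<in> {1..n}. j i \<le> c}"
  have mono: "j k \<le> j l" if "k \<le> l" "1 \<le> k" "l \<le> n" for k l
    using that(1,3)
  proof (induction rule: dec_induct)
    case (step m)
    then have "j m \<le> j (Suc m)" using j that(2) by auto
    with step show ?case by simp
  qed simp
  have "?D = {1..card ?D}"
  proof (rule down_closed_eq_atLeastAtMost)
    fix i k assume "i \<in> ?D" "1 \<le> k" "k \<le> i"
    then show "k \<in> ?D" using mono[of k i] by auto
  qed auto
  moreover have "card ?D = psum_upto c"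
  proof -
    have "psum_upto c = (\<Sum>x\<le>c. content n j x)" using j by auto
    also have "\<dots> = (\<Sum>x\<le>c. card {i \<in> ?D. j i = x})"
      unfolding content_def by (intro sum.cong arg_cong[of _ _ card]) auto
    also have "\<dots> = card ?D" unfolding card_eq_sum by (rule sum.group) auto
    finally show ?thesis by simp
  qed
  ultimately have "?D = {1..psum_upto c}" by simp
  with i show ?thesis by (auto simp: set_eq_iff)
qed

text \<open>The quantile function of e: the only candidate for a weakly increasing coloring with
  content e.\<close>

definition weak_coloring :: "nat \<Rightarrow> nat" where
  "weak_coloring = (\<lambda>i\<in>{1..n}. LEAST c. i \<le> psum_upto c)"

lemma weak_coloring_eq:
  assumes "j \<in> weak_colorings"
  shows "j = weak_coloring"
proof
  fix i
  show "j i = weak_coloring i"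
  proof (cases "i \<in> {1..n}")
    case True
    then have "weak_coloring i = (LEAST c. j i \<le> c)"
      using weak_coloring_le_iff[OF assms True] by (simp add: weak_coloring_def)
    also have "\<dots> = j i" by (rule Least_equality) auto
    finally show ?thesis by simp
  next
    case False
    have "j \<in> extensional {1..n}" using assms by (auto simp: colorings_def PiE_def)
    with False show ?thesis by (auto simp: weak_coloring_def extensional_def)
  qed
qed

lemma weak_coloring_in: "weak_coloring \<in> weak_colorings"
proof -
  have le_iff: "weak_coloring i \<le> c \<longleftrightarrow> i \<le> psum_upto c" if "i \<in> {1..n}" for i c
  proof
    have "i \<le> psum_upto (weak_coloring i)"
      using that ex_le_psum_upto[of i] by (auto simp: weak_coloring_def intro: LeastI_ex)
    then show "weak_coloring i \<le> c \<Longrightarrow> i \<le> psum_upto c"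
      using psum_upto_mono le_trans by blast
    show "i \<le> psum_upto c \<Longrightarrow> weak_coloring i \<le> c"
      using that by (simp add: weak_coloring_def Least_le)
  qed
  have e0: "e 0 = 0" using content by (simp add: is_content_def)
  have pos: "weak_coloring i \<noteq> 0" if "i \<in> {1..n}" for i
    using le_iff[OF that, of 0] that e0 by auto
  have "content n weak_coloring c = e c" for c
  proof (cases c)
    case 0
    then show ?thesis using e0 pos by (auto simp: content_def)
  next
    case (Suc b)
    have "{i \<in> {1..n}. weak_coloring i = c} = {psum_upto b<..psum_upto c}"
    proof (intro set_eqI)
      fix i
      show "i \<in> {i \<in> {1..n}. weak_coloring i = c} \<longleftrightarrow> i \<in> {psum_upto b<..psum_upto c}"
      proof (cases "i \<in> {1..n}")
        case True
        have "weak_coloring i = c \<longleftrightarrow> weak_coloring i \<le> c \<and> \<not> weak_coloring i \<le> b"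
          using Suc by auto
        then have "weak_coloring i = c \<longleftrightarrow> i \<le> psum_upto c \<and> \<not> i \<le> psum_upto b"
          by (simp only: le_iff[OF True])
        moreover have "i \<in> {psum_upto b<..psum_upto c} \<longleftrightarrow> i \<le> psum_upto c \<and> \<not> i \<le> psum_upto b"
          by (simp only: greaterThanAtMost_iff not_le conj_commute)
        ultimately show ?thesis using True by (simp only: mem_Collect_eq simp_thms)
      next
        case False
        then show ?thesis using psum_upto_le[of c] by auto
      qed
    qed
    then show ?thesis using Suc by (simp add: content_def)
  qed
  moreover have "weak_coloring i \<le> weak_coloring (Suc i)" if "i \<in> {1..<n}" for i
  proof -
    have "Suc i \<le> psum_upto (weak_coloring (Suc i))" using le_iff[of "Suc i"] that by auto
    then show ?thesis using le_iff[of i] that by auto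
  qed
  moreover have "weak_coloring \<in> colorings n"
    unfolding colorings_def
  proof (rule PiE_I)
    show "weak_coloring i \<in> {1..}" if "i \<in> {1..n}" for i using pos[OF that] by simp
    show "weak_coloring i = undefined" if "i \<notin> {1..n}" for i
      using that by (simp only: weak_coloring_def restrict_apply if_False)
  qed
  ultimately show ?thesis by auto
qed

lemma weak_coloring_less_iff:
  assumes "i \<in> {1..<n}"
  shows "weak_coloring i < weak_coloring (Suc i) \<longleftrightarrow> i \<in> psums (parts e)"
proof -
  have i: "i \<in> {1..n}" "Suc i \<in> {1..n}" using assms by auto
  note le = weak_coloring_le_iff[OF weak_coloring_in i(1)] weak_coloring_le_iff[OF weak_coloring_in i(2)]
  show ?thesis unfolding psums_parts[OF content]
  proof
    assume "weak_coloring i < weak_coloring (Suc i)"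
    \<comment> \<open>The cumulative sum at the colour of i reaches i but not i + 1.\<close>
    then have "i = psum_upto (weak_coloring i)"
      using le(1)[of "weak_coloring i"] le(2)[of "weak_coloring i"] by simp
    then show "i \<in> range psum_upto" by blast
  next
    assume "i \<in> range psum_upto"
    then obtain c where "i = psum_upto c" by blast
    then show "weak_coloring i < weak_coloring (Suc i)" using le(1)[of c] le(2)[of c] by simp
  qed
qed

text \<open>The single candidate \<open>weak_coloring\<close> ascends strictly exactly at the cut
  points of \<open>parts e\<close>. So F_T is the sum of the M_\<beta> with
  \<open>T \<subseteq> Sset \<beta>\<close>.\<close>

lemma Fcoeff_eq:
  assumes "T \<subseteq> {1..<n}"
  shows "Fcoeff n T e = (if T \<subseteq> Sset (parts e) then 1 else 0)"
proof -
  have S: "Sset (parts e) = psums (parts e) - {0, n}"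
    using Sset_eq_psums in_compsD[OF parts_in_comps[OF content]] by metis
  have iff: "(\<forall>i\<in>T. weak_coloring i < weak_coloring (Suc i)) \<longleftrightarrow> T \<subseteq> Sset (parts e)"
  proof -
    have "weak_coloring i < weak_coloring (Suc i) \<longleftrightarrow> i \<in> Sset (parts e)" if "i \<in> T" for i
    proof -
      have "i \<in> {1..<n}" using assms that by blast
      then show ?thesis using weak_coloring_less_iff[of i] unfolding S by simp
    qed
    then show ?thesis by blast
  qed
  have "{j \<in> colorings n. (\<forall>i\<in>{1..<n}. j i \<le> j (Suc i)) \<and> (\<forall>i\<in>T. j i < j (Suc i)) \<and> content n j = e}
    = (if T \<subseteq> Sset (parts e) then {weak_coloring} else {})" (is "?L = ?R")
  proof (intro equalityI subsetI)
    fix j assume "j \<in> ?L"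
    moreover from this have "j = weak_coloring" by (intro weak_coloring_eq) blast
    ultimately show "j \<in> ?R" using iff by auto
  next
    fix j assume "j \<in> ?R"
    then have "j = weak_coloring" "T \<subseteq> Sset (parts e)" by (auto split: if_splits)
    then show "j \<in> ?L" using iff weak_coloring_in by blast
  qed
  then show ?thesis by (simp add: Fcoeff_def)
qed

end

lemma Fcoeff_eq_0: "\<not> is_content n e \<Longrightarrow> Fcoeff n T e = 0"
proof -
  assume "\<not> is_content n e"
  then have "{j \<in> colorings n. (\<forall>i\<in>{1..<n}. j i \<le> j (Suc i)) \<and> (\<forall>i\<in>T. j i < j (Suc i)) \<and> content n j = e} = {}"
    using is_content_content by blast
  then show ?thesis unfolding Fcoeff_def by (metis card.empty)
qed

lemma Fseries_eq:
  "Fseries n d e = (if is_content n e then sum d (Pow (Sset (parts e))) else 0)"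
proof (cases "is_content n e")
  case True
  then have "Sset (parts e) \<subseteq> {1..<n}" by (intro Sset_subset parts_in_comps)
  then have "(\<Sum>T\<in>Pow {1..<n}. if T \<in> Pow (Sset (parts e)) then d T else 0) = sum d (Pow {1..<n} \<inter> Pow (Sset (parts e)))"
    "Pow {1..<n} \<inter> Pow (Sset (parts e)) = Pow (Sset (parts e))"
    by (auto simp: sum.inter_restrict)
  moreover have "Fseries n d e = (\<Sum>T\<in>Pow {1..<n}. if T \<in> Pow (Sset (parts e)) then d T else 0)"
    unfolding Fseries_def by (rule sum.cong) (use True in \<open>auto simp: Fcoeff_eq\<close>)
  ultimately show ?thesis using True by simp
qed (simp add: Fseries_def Fcoeff_eq_0)

section \<open>Coefficients of the monomial functions and of Psi\<close>

lemma Mcoeff_eq: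
  assumes "\<beta> \<in> comps n"
  shows "Mcoeff \<beta> e = (if is_content n e \<and> parts e = \<beta> then 1 else 0)"
proof -
  let ?L = "length \<beta>" and ?s = "sorted_list_of_set {c. e c \<noteq> 0}"
  let ?A = "{i \<in> PiE {..<?L} (\<lambda>_. {1..}). (\<forall>k. Suc k < ?L \<longrightarrow> i k < i (Suc k)) \<and>
      (\<forall>c. e c = (\<Sum>k \<in> {k. k < ?L \<and> i k = c}. \<beta> ! k))}"
  have nz: "\<beta> ! k \<noteq> 0" if "k < ?L" for k
    using that in_compsD(1)[OF assms] nth_mem by metis
  \<comment> \<open>The index map is forced: it is strictly increasing, and as all parts are nonzero
    its image is the support of e.\<close>
  have A: "is_content n e \<and> parts e = \<beta> \<and> i = (\<lambda>k\<in>{..<?L}. ?s ! k)" if "i \<in> ?A" for i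
  proof -
    let ?t = "map i [0..<?L]"
    have sorted: "sorted_wrt (<) ?t"
      using that by (auto simp: sorted_wrt_iff_nth_Suc_transp)
    then have "distinct ?t" using strict_sorted_iff by blast
    then have inj: "i k = i l \<longleftrightarrow> k = l" if "k < ?L" "l < ?L" for k l
      using that by (auto simp: distinct_map inj_on_def)
    have e: "e c = (\<Sum>k | k < ?L \<and> i k = c. \<beta> ! k)" for c using that by blast
    have ei: "e (i k) = \<beta> ! k" if "k < ?L" for k
    proof -
      have "{l. l < ?L \<and> i l = i k} = {k}" using inj that by auto
      then show ?thesis by (simp add: e)
    qed
    have supp: "{c. e c \<noteq> 0} = set ?t"
    proof (intro equalityI subsetI)
      fix c assume c: "c \<in> {c. e c \<noteq> 0}"
      have "{k. k < ?L \<and> i k = c} \<noteq> {}"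
      proof
        assume "{k. k < ?L \<and> i k = c} = {}"
        then have "e c = 0" unfolding e by (simp only: sum.empty)
        with c show False by simp
      qed
      then show "c \<in> set ?t" by auto
    next
      fix c assume "c \<in> set ?t"
      then show "c \<in> {c. e c \<noteq> 0}" using ei nz by auto
    qed
    have s: "?s = ?t" unfolding supp using sorted
      by (intro strict_sorted_equal) (auto simp: strict_sorted_list_of_set simp del: set_map)
    have p: "parts e = \<beta>" unfolding parts_def s by (rule nth_equalityI) (auto simp: ei)
    have "(\<Sum>c | e c \<noteq> 0. e c) = sum_list (parts e)"
      unfolding parts_def supp s using \<open>distinct ?t\<close> by (simp add: sum_list_distinct_conv_sum_set del: map_map)
    moreover have "i k \<in> {1..}" if "k < ?L" for k
      using \<open>i \<in> ?A\<close> that by (intro PiE_mem[of i "{..<?L}"]) auto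
    then have "0 \<notin> {c. e c \<noteq> 0}" unfolding supp by fastforce
    moreover have "finite {c. e c \<noteq> 0}" unfolding supp by simp
    ultimately have "is_content n e" using assms unfolding is_content_def p by (simp add: comps_def)
    moreover have "i = (\<lambda>k\<in>{..<?L}. ?s ! k)"
      unfolding s using that by (intro extensionalityI[of _ "{..<?L}"]) (auto simp: PiE_def)
    ultimately show ?thesis using p by blast
  qed
  show ?thesis
  proof (cases "is_content n e \<and> parts e = \<beta>")
    case True
    then have fin: "finite {c. e c \<noteq> 0}" and e0: "e 0 = 0" by (auto simp: is_content_def)
    have pe: "map e ?s = \<beta>" using True by (simp only: parts_def simp_thms)
    then have len: "length ?s = ?L" by (metis length_map)
    have sorted: "sorted_wrt (<) ?s" by (rule strict_sorted_list_of_set)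
    have dist: "distinct ?s" by simp
    have es: "e (?s ! k) = \<beta> ! k" if "k < ?L" for k
      using that len nth_map[of k ?s e] unfolding pe by simp
    define i where "i = (\<lambda>k\<in>{..<?L}. ?s ! k)"
    have "i \<in> PiE {..<?L} (\<lambda>_. {1..})"
    proof (rule PiE_I)
      fix k assume k: "k \<in> {..<?L}"
      then have "?s ! k \<in> set ?s" using len by (intro nth_mem) simp
      then have "e (?s ! k) \<noteq> 0" unfolding set_sorted_list_of_set[OF fin] by (rule CollectD)
      then have "?s ! k \<noteq> 0" using e0 by metis
      with k show "i k \<in> {1..}" unfolding i_def by (simp add: Suc_le_eq)
    qed (simp add: i_def)
    moreover have "\<forall>k. Suc k < ?L \<longrightarrow> i k < i (Suc k)"
      using sorted len by (auto simp: i_def sorted_wrt_iff_nth_less)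
    moreover have "e c = (\<Sum>k | k < ?L \<and> i k = c. \<beta> ! k)" for c
    proof (cases "e c = 0")
      case True
      have "i k \<noteq> c" if "k < ?L" for k
      proof
        assume "i k = c"
        then have "e (?s ! k) = 0" using True that by (simp add: i_def)
        then show False using es[OF that] nz[OF that] by (simp only:)
      qed
      then have "{k. k < ?L \<and> i k = c} = {}" by blast
      then show ?thesis using True by (simp only: sum.empty)
    next
      case False
      then have "c \<in> set ?s" using fin by simp
      then obtain k where k: "k < ?L" "?s ! k = c" using len by (metis in_set_conv_nth)
      have "{k. k < ?L \<and> i k = c} = {k}"
        using k dist len by (auto simp: i_def nth_eq_iff_index_eq)
      moreover have "e c = \<beta> ! k" using es[OF k(1)] by (simp only: k(2))
      ultimately show ?thesis by simp
    qed
    ultimately have "i \<in> ?A" by blast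
    then have "?A = {i}" using A i_def by blast
    then show ?thesis using True unfolding Mcoeff_def by simp
  next
    case False
    then have "?A = {}" using A by blast
    then show ?thesis using False unfolding Mcoeff_def by (simp only: card.empty if_False)
  qed
qed

lemma zee_nonzero: "0 \<notin> set \<alpha> \<Longrightarrow> zee \<alpha> \<noteq> 0"
  by (auto simp: zee_def)

text \<open>The factor z_\<alpha> cancels, and among the monomial functions in Psi_\<alpha> only the
  one for \<open>parts e\<close> contains x^e.\<close>

lemma Psi_expansion_eq:
  "Psi_expansion n c e = (if is_content n e
     then \<Sum>\<alpha> | \<alpha> \<in> comps n \<and> comp_le \<alpha> (parts e). smult (inverse (of_nat (pi_pair \<alpha> (parts e)))) (c \<alpha>)
     else 0)"
proof -
  have Psi: "Psi n \<alpha> e / of_nat (zee \<alpha>) =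
    (if is_content n e \<and> comp_le \<alpha> (parts e) then inverse (of_nat (pi_pair \<alpha> (parts e))) else 0)"
    if "\<alpha> \<in> comps n" for \<alpha>
  proof -
    have "Psi n \<alpha> e / of_nat (zee \<alpha>) =
      (\<Sum>\<beta> | \<beta> \<in> comps n \<and> comp_le \<alpha> \<beta>. of_nat (Mcoeff \<beta> e) / of_nat (pi_pair \<alpha> \<beta>))"
      using zee_nonzero[of \<alpha>] that by (auto simp: Psi_def comps_def)
    also have "\<dots> = (\<Sum>\<beta> | \<beta> \<in> comps n \<and> comp_le \<alpha> \<beta>.
        if \<beta> = parts e then (if is_content n e then inverse (of_nat (pi_pair \<alpha> (parts e))) else 0) else 0)"
      by (rule sum.cong) (auto simp: Mcoeff_eq[where n = n] inverse_eq_divide)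
    also have "\<dots> = (if is_content n e \<and> comp_le \<alpha> (parts e) then inverse (of_nat (pi_pair \<alpha> (parts e))) else 0)"
      using parts_in_comps by (subst sum.delta) auto
    finally show ?thesis .
  qed
  show ?thesis
  proof (cases "is_content n e")
    case True
    have "Psi_expansion n c e = (\<Sum>\<alpha>\<in>comps n. if comp_le \<alpha> (parts e)
      then smult (inverse (of_nat (pi_pair \<alpha> (parts e)))) (c \<alpha>) else 0)"
      unfolding Psi_expansion_def by (rule sum.cong) (use True in \<open>auto simp: Psi\<close>)
    also have "\<dots> = (\<Sum>\<alpha> | \<alpha> \<in> comps n \<and> comp_le \<alpha> (parts e).
        smult (inverse (of_nat (pi_pair \<alpha> (parts e)))) (c \<alpha>))"
      by (rule sum.inter_filter[symmetric]) simp
    finally show ?thesis using True by simp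
  qed (simp add: Psi_expansion_def Psi)
qed

text \<open>Induction over the palette: the class of the least colour is a set of minimal elements
  and can be removed. Nonzero multiplicities make every class nonempty, as
  \<open>minimal_sets\<close> demands.\<close>

lemma card_colorings_eq_chains:
  fixes r :: "(nat \<times> nat) set" and e :: "nat \<Rightarrow> nat"
  assumes "finite X" "sorted_wrt (<) s" "\<forall>c\<in>set s. e c \<noteq> 0"
  shows "card {\<kappa> \<in> PiE X (\<lambda>_. UNIV). (\<forall>i\<in>X. \<forall>j\<in>X. (i, j) \<in> r \<longrightarrow> \<kappa> i < \<kappa> j) \<and>
      (\<forall>c. card {i \<in> X. \<kappa> i = c} = (if c \<in> set s then e c else 0))} =
    chains (minimal_sets r) (map e s) X"
  using assms
proof (induction s arbitrary: X)
  case Nil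
  have "{\<kappa> \<in> PiE X (\<lambda>_. UNIV). (\<forall>i\<in>X. \<forall>j\<in>X. (i, j) \<in> r \<longrightarrow> \<kappa> i < \<kappa> j) \<and>
      (\<forall>c. card {i \<in> X. \<kappa> i = c} = (if c \<in> set [] then e c else 0))} =
    (if X = {} then {\<lambda>_. undefined} else {})" (is "?A = _")
  proof (cases "X = {}")
    case False
    then obtain x where x: "x \<in> X" by blast
    have "?A = {}"
    proof (rule equals0I)
      fix \<kappa> assume "\<kappa> \<in> ?A"
      then have "\<forall>c. card {i \<in> X. \<kappa> i = c} = (if c \<in> set [] then e c else 0)" by blast
      then have "card {i \<in> X. \<kappa> i = \<kappa> x} = 0" by simp
      then show False using x Nil.prems(1) by auto
    qed
    then show ?thesis using False by (simp only: if_False)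
  qed auto
  then show ?case by (simp only: chains.simps list.map split: if_split) simp
next
  case (Cons c s)
  define K where "K s X = {\<kappa> \<in> PiE X (\<lambda>_. UNIV). (\<forall>i\<in>X. \<forall>j\<in>X. (i, j) \<in> r \<longrightarrow> \<kappa> i < \<kappa> j) \<and>
      (\<forall>c. card {i \<in> X. \<kappa> i = c} = (if c \<in> set s then e c else 0))}" for s X
  have K_mem: "\<kappa> i \<in> set s" if "\<kappa> \<in> K s X" "i \<in> X" "finite X" for \<kappa> i s X
  proof -
    have "card {j \<in> X. \<kappa> j = \<kappa> i} \<noteq> 0" using that by auto
    moreover have "card {j \<in> X. \<kappa> j = \<kappa> i} = (if \<kappa> i \<in> set s then e (\<kappa> i) else 0)"
      using that(1) unfolding K_def by blast
    ultimately show ?thesis by (metis (full_types))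
  qed
  \<comment> \<open>Values are a priori arbitrary naturals, so finiteness has to come from the
    finite palette s.\<close>
  have finK: "finite (K s X)" if "finite X" for s X
  proof (rule finite_subset)
    show "K s X \<subseteq> PiE X (\<lambda>_. set s)"
    proof
      fix \<kappa> assume \<kappa>: "\<kappa> \<in> K s X"
      then have "\<kappa> \<in> extensional X" by (simp add: K_def PiE_def)
      with K_mem[OF \<kappa> _ that] show "\<kappa> \<in> PiE X (\<lambda>_. set s)" by (simp add: PiE_iff)
    qed
    show "finite (PiE X (\<lambda>_. set s))" using that by (intro finite_PiE) auto
  qed
  have less: "\<forall>d\<in>set s. c < d" using Cons.prems(2) by simp
  then have c: "c \<notin> set s" by (metis less_irrefl)
  let ?B = "SIGMA Z:{Z \<in> minimal_sets r X. card Z = e c}. K s (X - Z)"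
  have "bij_betw (\<lambda>\<kappa>. ({i \<in> X. \<kappa> i = c}, restrict \<kappa> (X - {i \<in> X. \<kappa> i = c}))) (K (c # s) X) ?B"
  proof (rule bij_betw_byWitness[where f' = "\<lambda>(Z, \<kappa>) i. if i \<in> Z then c else \<kappa> i"])
    show "\<forall>\<kappa>\<in>K (c # s) X. (\<lambda>(Z, \<kappa>) i. if i \<in> Z then c else \<kappa> i)
        ({i \<in> X. \<kappa> i = c}, restrict \<kappa> (X - {i \<in> X. \<kappa> i = c})) = \<kappa>"
      by (auto simp: K_def PiE_iff extensional_def)
    show "\<forall>b\<in>?B. (\<lambda>\<kappa>. ({i \<in> X. \<kappa> i = c}, restrict \<kappa> (X - {i \<in> X. \<kappa> i = c})))
        ((\<lambda>(Z, \<kappa>) i. if i \<in> Z then c else \<kappa> i) b) = b"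
    proof
      fix b assume "b \<in> ?B"
      then obtain Z \<kappa> where b: "b = (Z, \<kappa>)" "Z \<in> minimal_sets r X" "\<kappa> \<in> K s (X - Z)" by auto
      have "\<kappa> i \<noteq> c" if "i \<in> X - Z" for i using K_mem[OF b(3) that] c Cons.prems(1) by auto
      moreover have "Z \<subseteq> X" using b by (auto simp: minimal_sets_def)
      ultimately have Z: "{i \<in> X. (if i \<in> Z then c else \<kappa> i) = c} = Z" by auto
      have "restrict (\<lambda>i. if i \<in> Z then c else \<kappa> i) (X - Z) = \<kappa>"
        using b(3) by (auto simp: K_def PiE_iff extensional_def restrict_def)
      with Z b(1) show "(\<lambda>\<kappa>. ({i \<in> X. \<kappa> i = c}, restrict \<kappa> (X - {i \<in> X. \<kappa> i = c})))
        ((\<lambda>(Z, \<kappa>) i. if i \<in> Z then c else \<kappa> i) b) = b" by simp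
    qed
    show "(\<lambda>\<kappa>. ({i \<in> X. \<kappa> i = c}, restrict \<kappa> (X - {i \<in> X. \<kappa> i = c}))) ` K (c # s) X \<subseteq> ?B"
    proof (rule image_subsetI)
      fix \<kappa> assume \<kappa>: "\<kappa> \<in> K (c # s) X"
      let ?Z = "{i \<in> X. \<kappa> i = c}"
      have cnt: "card {i \<in> X. \<kappa> i = d} = (if d \<in> set (c # s) then e d else 0)" for d
        using \<kappa> unfolding K_def by blast
      have Zc: "card ?Z = e c" using cnt[of c] by simp
      then have "?Z \<noteq> {}" using Cons.prems by (metis card.empty list.set_intros(1))
      moreover have "(x, z) \<notin> r" if "z \<in> ?Z" "x \<in> X" for x z
      proof
        assume "(x, z) \<in> r"
        then have "\<kappa> x < c" using \<kappa> that by (auto simp: K_def)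
        moreover have "\<kappa> x \<in> set (c # s)" using K_mem[OF \<kappa> that(2)] Cons.prems by simp
        ultimately show False using less by auto
      qed
      ultimately have "?Z \<in> minimal_sets r X" by (auto simp: minimal_sets_def)
      moreover have "card {i \<in> X - ?Z. restrict \<kappa> (X - ?Z) i = d} = (if d \<in> set s then e d else 0)" for d
      proof (cases "d = c")
        case True
        have empty: "{i \<in> X - ?Z. restrict \<kappa> (X - ?Z) i = d} = {}" using True by auto
        show ?thesis unfolding empty using True c by simp
      next
        case False
        then have "{i \<in> X - ?Z. restrict \<kappa> (X - ?Z) i = d} = {i \<in> X. \<kappa> i = d}" by auto
        with False cnt[of d] show ?thesis by simp
      qed
      moreover have "\<forall>i\<in>X - ?Z. \<forall>j\<in>X - ?Z. (i, j) \<in> r \<longrightarrow> restrict \<kappa> (X - ?Z) i < restrict \<kappa> (X - ?Z) j"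
        using \<kappa> by (auto simp: K_def)
      moreover have "restrict \<kappa> (X - ?Z) \<in> PiE (X - ?Z) (\<lambda>_. UNIV)" by auto
      ultimately have "?Z \<in> {Z \<in> minimal_sets r X. card Z = e c}" "restrict \<kappa> (X - ?Z) \<in> K s (X - ?Z)"
        using Zc unfolding K_def by (blast, fast)
      then show "(?Z, restrict \<kappa> (X - ?Z)) \<in> ?B" by (rule SigmaI)
    qed
    show "(\<lambda>(Z, \<kappa>) i. if i \<in> Z then c else \<kappa> i) ` ?B \<subseteq> K (c # s) X"
    proof (rule image_subsetI)
      fix b assume "b \<in> ?B"
      then obtain Z \<kappa> where b: "b = (Z, \<kappa>)" "Z \<in> minimal_sets r X" "\<kappa> \<in> K s (X - Z)" "card Z = e c"
        by auto
      let ?k = "\<lambda>i. if i \<in> Z then c else \<kappa> i"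
      have ZX: "Z \<subseteq> X" and Zmin: "\<And>x z. z \<in> Z \<Longrightarrow> x \<in> X \<Longrightarrow> (x, z) \<notin> r"
        using b by (auto simp: minimal_sets_def)
      have mem: "\<kappa> i \<in> set s" if "i \<in> X - Z" for i using K_mem[OF b(3) that] Cons.prems by auto
      have "?k \<in> PiE X (\<lambda>_. UNIV)" using b(3) ZX by (auto simp: K_def PiE_iff extensional_def)
      moreover have "?k i < ?k j" if "i \<in> X" "j \<in> X" "(i, j) \<in> r" for i j
      proof -
        have "j \<notin> Z" using Zmin that by blast
        then show ?thesis using that mem[of j] less b(3) by (auto simp: K_def)
      qed
      moreover have "card {i \<in> X. ?k i = d} = (if d \<in> set (c # s) then e d else 0)" for d
      proof (cases "d = c")
        case True
        have "{i \<in> X. ?k i = d} = Z" using True ZX mem less by auto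
        then show ?thesis using True b(4) by simp
      next
        case False
        then have "{i \<in> X. ?k i = d} = {i \<in> X - Z. \<kappa> i = d}" by auto
        then show ?thesis using b(3) False by (simp add: K_def)
      qed
      ultimately have "?k \<in> K (c # s) X" unfolding K_def by blast
      then show "(\<lambda>(Z, \<kappa>) i. if i \<in> Z then c else \<kappa> i) b \<in> K (c # s) X" using b(1) by simp
    qed
  qed
  then have "card (K (c # s) X) = card ?B" by (rule bij_betw_same_card)
  also have "\<dots> = (\<Sum>Z | Z \<in> minimal_sets r X \<and> card Z = e c. card (K s (X - Z)))"
    using Cons.prems(1) finK by (intro card_SigmaI) auto
  also have "\<dots> = chains (minimal_sets r) (map e (c # s)) X"
  proof -
    have "card (K s Y) = chains (minimal_sets r) (map e s) Y" if "finite Y" for Y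
      unfolding K_def by (rule Cons.IH) (use that Cons.prems in simp_all)
    then show ?thesis using Cons.prems(1) by simp
  qed
  finally show ?case unfolding K_def .
qed

section \<open>Positivity\<close>

lemma sum_supersets_neg_one_power:
  assumes "finite N" "A \<subseteq> N"
  shows "(\<Sum>V | V \<subseteq> N \<and> A \<subseteq> V. (-1) ^ card (N - V)) = (if A = N then 1 else 0 :: 'b :: comm_ring_1)"
proof (cases "A = N")
  case True
  then have "{V. V \<subseteq> N \<and> A \<subseteq> V} = {N}" by auto
  then show ?thesis using True by simp
next
  case False
  have "(-1) ^ card (N - V) = (-1) ^ card N * ((-1) ^ card V :: 'b)" if "V \<subseteq> N" for V
    using that assms(1) by (simp add: card_Diff_subset finite_subset card_mono
        neg_one_power_add_eq_neg_one_power_diff flip: power_add)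
  then have "(\<Sum>V | V \<subseteq> N \<and> A \<subseteq> V. (-1) ^ card (N - V)) =
      (-1) ^ card N * (\<Sum>V | V \<subseteq> N \<and> A \<subseteq> V. (-1) ^ card V :: 'b)"
    by (simp add: sum_distrib_left)
  also have "(\<Sum>V | V \<subseteq> N \<and> A \<subseteq> V. (-1) ^ card V :: 'b) = 0"
  proof (rule sum_alternating_cancels)
    show "finite {V. V \<subseteq> N \<and> A \<subseteq> V}" using assms(1) by (rule finite_subset[rotated, OF finite_Pow_iff[THEN iffD2]]) auto
    have "A \<subset> N" using False assms(2) by blast
    from card_subsupersets_even_odd[OF assms(1) this]
    show "card {V \<in> {V. V \<subseteq> N \<and> A \<subseteq> V}. even (card V)} = card {V \<in> {V. V \<subseteq> N \<and> A \<subseteq> V}. odd (card V)}"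
      by (simp add: conj_assoc)
  qed
  finally show ?thesis using False by simp
qed

lemma reflect_image:
  fixes n :: nat
  assumes "T \<subseteq> {1..<n}"
  shows "(\<lambda>x. n - x) ` T \<subseteq> {1..<n}" "(\<lambda>x. n - x) ` (\<lambda>x. n - x) ` T = T"
proof -
  have "n - x \<in> {1..<n}" if "x \<in> T" for x
    using subsetD[OF assms that] by auto
  then show "(\<lambda>x. n - x) ` T \<subseteq> {1..<n}" by blast
  have "n - (n - x) = x" if "x \<in> T" for x using that assms by auto
  then show "(\<lambda>x. n - x) ` (\<lambda>x. n - x) ` T = T" by (simp add: image_image)
qed

lemma omega_set_subset: "omega_set n T \<subseteq> {1..<n}"
  by (auto simp: omega_set_def)

text \<open>Reflection is an involution of \<open>{1..<n}\<close> that commutes with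
  complementation, so a second reflection leaves only the complement.\<close>

lemma reflect_omega_set:
  assumes "T \<subseteq> {1..<n}"
  shows "(\<lambda>x. n - x) ` omega_set n T = {1..<n} - T"
proof -
  have inj: "inj_on (\<lambda>x. n - x) {1..<n}" by (auto simp: inj_on_def)
  have all: "(\<lambda>x. n - x) ` {1..<n} = {1..<n}"
    using reflect_image[of "{1..<n}" n] by (metis image_mono subset_antisym order_refl)
  show ?thesis unfolding omega_set_def
    using inj_on_image_set_diff[OF inj, of "{1..<n}" "(\<lambda>x. n - x) ` T"] reflect_image[OF assms]
    by (simp only: all Diff_subset subset_refl)
qed

lemma omega_set_involution:
  assumes "T \<subseteq> {1..<n}"
  shows "omega_set n (omega_set n T) = T"
proof -
  have "omega_set n (omega_set n T) = {1..<n} - ({1..<n} - T)"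
    unfolding omega_set_def[of n "omega_set n T"] by (simp only: reflect_omega_set[OF assms])
  then show ?thesis using assms by blast
qed

text \<open>Here a gives the M-coefficients of the series with F-coefficients d. Reindexed by the
  involution, \<open>a (rev \<alpha>)\<close> sums \<open>d (omega_set n T)\<close> over the T
  containing the complement of \<open>Sset \<alpha>\<close>. After exchanging sums, T carries a
  signed count of the sets V containing both \<open>Sset \<beta>\<close> and the complement of T,
  which is 1 if \<open>T \<subseteq> Sset \<beta>\<close> and 0 otherwise.\<close>

lemma sum_omega_set:
  fixes d :: "nat set \<Rightarrow> 'b :: comm_ring_1"
  assumes d: "\<And>\<beta>. \<beta> \<in> comps n \<Longrightarrow> sum d (Pow (Sset \<beta>)) = a \<beta>" and \<beta>: "\<beta> \<in> comps n"
  shows "(\<Sum>T\<in>Pow (Sset \<beta>). d (omega_set n T)) =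
    (\<Sum>\<alpha> | \<alpha> \<in> comps n \<and> comp_le \<alpha> \<beta>. (-1) ^ (n + length \<alpha>) * a (rev \<alpha>))"
proof -
  let ?N = "{1..<n}"
  \<comment> \<open>The summand in terms of the cut set V, so that the sum over compositions can be
    moved to subsets of \<open>{1..<n}\<close> along \<open>bij_betw_Sset\<close>.\<close>
  define h where "h V = (\<Sum>T | T \<in> Pow ?N \<and> ?N - T \<subseteq> V. (-1) ^ card (?N - V) * d (omega_set n T))" for V
  have h: "(-1) ^ (n + length \<alpha>) * a (rev \<alpha>) = h (Sset \<alpha>)" if \<alpha>: "\<alpha> \<in> comps n" for \<alpha>
  proof -
    have "length \<alpha> \<le> n" using \<alpha> length_le_sum_list by (auto simp: comps_def)
    then have sign: "(-1) ^ (n + length \<alpha>) = ((-1) ^ card (?N - Sset \<alpha>) :: 'b)"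
      using card_compl_Sset[OF \<alpha>] by (simp add: neg_one_power_add_eq_neg_one_power_diff)
    note S = Sset_subset[OF \<alpha>]
    have "a (rev \<alpha>) = sum d (Pow ((\<lambda>x. n - x) ` Sset \<alpha>))"
      using d[of "rev \<alpha>"] \<alpha> by (simp add: Sset_rev)
    also have "\<dots> = (\<Sum>T | T \<in> Pow ?N \<and> ?N - T \<subseteq> Sset \<alpha>. d (omega_set n T))"
    proof (rule sum.reindex_bij_witness[where i = "omega_set n" and j = "omega_set n"])
      fix T assume "T \<in> Pow ((\<lambda>x. n - x) ` Sset \<alpha>)"
      then have T: "T \<subseteq> (\<lambda>x. n - x) ` Sset \<alpha>" by blast
      then have TN: "T \<subseteq> ?N" using reflect_image(1)[OF S] by blast
      then show 1: "omega_set n (omega_set n T) = T" by (rule omega_set_involution)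
      then show "d (omega_set n (omega_set n T)) = d T" by simp
      have "(\<lambda>x. n - x) ` T \<subseteq> Sset \<alpha>" using image_mono[OF T] reflect_image(2)[OF S] by metis
      then have "?N - omega_set n T \<subseteq> Sset \<alpha>" unfolding omega_set_def by blast
      then show "omega_set n T \<in> {T. T \<in> Pow ?N \<and> ?N - T \<subseteq> Sset \<alpha>}"
        using omega_set_subset by blast
    next
      fix T assume T: "T \<in> {T. T \<in> Pow ?N \<and> ?N - T \<subseteq> Sset \<alpha>}"
      then show "omega_set n (omega_set n T) = T" by (intro omega_set_involution) blast
      have "T \<subseteq> ?N" using T by blast
      have "omega_set n T = (\<lambda>x. n - x) ` (\<lambda>x. n - x) ` omega_set n T"
        using reflect_image(2)[OF omega_set_subset] by metis
      also have "\<dots> = (\<lambda>x. n - x) ` (?N - T)" by (simp only: reflect_omega_set[OF \<open>T \<subseteq> ?N\<close>])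
      also have "\<dots> \<subseteq> (\<lambda>x. n - x) ` Sset \<alpha>" using T by (intro image_mono) blast
      finally show "omega_set n T \<in> Pow ((\<lambda>x. n - x) ` Sset \<alpha>)" by (rule PowI)
    qed
    finally show ?thesis unfolding h_def sign by (simp only: sum_distrib_left)
  qed
  have "(\<Sum>\<alpha> | \<alpha> \<in> comps n \<and> comp_le \<alpha> \<beta>. (-1) ^ (n + length \<alpha>) * a (rev \<alpha>)) =
    (\<Sum>\<alpha>\<in>comps n. if Sset \<beta> \<subseteq> Sset \<alpha> then h (Sset \<alpha>) else 0)"
    unfolding comp_le_def by (subst sum.inter_filter) (simp_all add: h cong: if_cong sum.cong)
  also have "\<dots> = (\<Sum>V\<in>Pow ?N. if Sset \<beta> \<subseteq> V then h V else 0)"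
    by (rule sum.reindex_bij_betw[OF bij_betw_Sset])
  also have "\<dots> = (\<Sum>V | V \<in> Pow ?N \<and> Sset \<beta> \<subseteq> V. h V)"
    by (rule sum.inter_filter[symmetric]) simp
  also have "\<dots> = (\<Sum>T\<in>Pow ?N. \<Sum>V | V \<in> {V \<in> Pow ?N. Sset \<beta> \<subseteq> V} \<and> ?N - T \<subseteq> V.
      (-1) ^ card (?N - V) * d (omega_set n T))"
    unfolding h_def by (rule sum.swap_restrict) auto
  also have "\<dots> = (\<Sum>T\<in>Pow ?N. if T \<subseteq> Sset \<beta> then d (omega_set n T) else 0)"
  proof (rule sum.cong[OF refl])
    fix T assume T: "T \<in> Pow ?N"
    let ?A = "Sset \<beta> \<union> (?N - T)"
    have A: "?A \<subseteq> ?N" using Sset_subset[OF \<beta>] by blast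
    have eq: "?A = ?N \<longleftrightarrow> T \<subseteq> Sset \<beta>" using A T by blast
    have "{V. V \<in> {V \<in> Pow ?N. Sset \<beta> \<subseteq> V} \<and> ?N - T \<subseteq> V} = {V. V \<subseteq> ?N \<and> ?A \<subseteq> V}" by blast
    then have "(\<Sum>V | V \<in> {V \<in> Pow ?N. Sset \<beta> \<subseteq> V} \<and> ?N - T \<subseteq> V. (-1) ^ card (?N - V) * d (omega_set n T)) =
      (\<Sum>V | V \<subseteq> ?N \<and> ?A \<subseteq> V. (-1) ^ card (?N - V)) * d (omega_set n T)"
      by (simp only: sum_distrib_right)
    also have "\<dots> = (if T \<subseteq> Sset \<beta> then d (omega_set n T) else 0)"
      by (subst sum_supersets_neg_one_power[OF _ A]) (simp_all only: eq, simp_all)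
    finally show "(\<Sum>V | V \<in> {V \<in> Pow ?N. Sset \<beta> \<subseteq> V} \<and> ?N - T \<subseteq> V. (-1) ^ card (?N - V) * d (omega_set n T)) =
      (if T \<subseteq> Sset \<beta> then d (omega_set n T) else 0)" .
  qed
  also have "\<dots> = (\<Sum>T | T \<in> Pow ?N \<and> T \<subseteq> Sset \<beta>. d (omega_set n T))"
    by (rule sum.inter_filter[symmetric]) simp
  also have "{T. T \<in> Pow ?N \<and> T \<subseteq> Sset \<beta>} = Pow (Sset \<beta>)"
    using Sset_subset[OF \<beta>] by blast
  finally show ?thesis by simp
qed

text \<open>Moebius inversion on the Boolean lattice of cut sets: any choice of monomial
  coefficients comes from an F-expansion.\<close>

lemma ex_sum_Pow_Sset:
  fixes a :: "nat list \<Rightarrow> 'b :: comm_ring_1"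
  shows "\<exists>d. \<forall>\<beta>\<in>comps n. sum d (Pow (Sset \<beta>)) = a \<beta>"
proof -
  define f where "f U = a (inv_into (comps n) Sset U)" for U
  define g where "g U = (\<Sum>T\<in>Pow U. (-1) ^ card T * f T)" for U
  have "sum (\<lambda>T. (-1) ^ card T * g T) (Pow (Sset \<beta>)) = a \<beta>" if "\<beta> \<in> comps n" for \<beta>
  proof -
    have "finite (Sset \<beta>)" using Sset_subset[OF that] by (rule finite_subset) simp
    then have "f (Sset \<beta>) = (\<Sum>T\<in>Pow (Sset \<beta>). (-1) ^ card T * g T)"
      by (rule inclusion_exclusion_symmetric[rotated]) (rule g_def)
    moreover have "inv_into (comps n) Sset (Sset \<beta>) = \<beta>"
      using bij_betw_Sset that by (intro inv_into_f_f) (simp_all add: bij_betw_def)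
    ultimately show ?thesis by (simp add: f_def)
  qed
  then show ?thesis by blast
qed

lemma pi_pair_nonzero:
  assumes "0 \<notin> set \<alpha>"
  shows "pi_pair \<alpha> \<beta> \<noteq> 0"
proof -
  have "pi_comp \<gamma> \<noteq> 0" if "0 \<notin> set \<gamma>" for \<gamma>
    using take_sum_list_less[OF that, of 0] by (fastforce simp: pi_comp_def)
  moreover have "0 \<notin> set (sub_comp \<alpha> \<beta> i)" for i
    using assms nth_mem by (fastforce simp: sub_comp_eq_filter)
  ultimately show ?thesis unfolding pi_pair_def by (simp only: prod_zero_iff finite_lessThan) blast
qed

text \<open>The system is triangular for refinement with nonzero diagonal entries
  1/pi(\<beta>,\<beta>). A proper refinement is longer, so the induction starts at the finest
  composition.\<close>

lemma Psi_coefficients_unique: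
  fixes c c' :: "nat list \<Rightarrow> rat poly"
  assumes eq: "\<And>\<beta>. \<beta> \<in> comps n \<Longrightarrow>
      (\<Sum>\<alpha> | \<alpha> \<in> comps n \<and> comp_le \<alpha> \<beta>. smult (inverse (of_nat (pi_pair \<alpha> \<beta>))) (c \<alpha>)) =
      (\<Sum>\<alpha> | \<alpha> \<in> comps n \<and> comp_le \<alpha> \<beta>. smult (inverse (of_nat (pi_pair \<alpha> \<beta>))) (c' \<alpha>))"
    and "\<beta> \<in> comps n"
  shows "c \<beta> = c' \<beta>"
  using assms(2)
proof (induction "n - length \<beta>" arbitrary: \<beta> rule: less_induct)
  case less
  note \<beta> = less.prems
  let ?R = "{\<alpha>. \<alpha> \<in> comps n \<and> comp_le \<alpha> \<beta>}"
  let ?s = "\<lambda>c \<alpha>. smult (inverse (of_nat (pi_pair \<alpha> \<beta>))) (c \<alpha>) :: rat poly"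
  have fin: "finite ?R" by (rule finite_subset[OF _ finite_comps]) blast
  have mem: "\<beta> \<in> ?R" using \<beta> by (simp add: comp_le_def)
  have "c \<alpha> = c' \<alpha>" if "\<alpha> \<in> ?R - {\<beta>}" for \<alpha>
  proof -
    have \<alpha>: "\<alpha> \<in> comps n" "\<alpha> \<noteq> \<beta>" and sub: "psums \<beta> \<subseteq> psums \<alpha>"
      using that \<beta> comp_le_iff_psums by auto
    have "psums \<beta> \<noteq> psums \<alpha>"
      using psums_inject[OF in_compsD(1)[OF \<alpha>(1)] in_compsD(1)[OF \<beta>]] \<alpha>(2) by metis
    with sub have "card (psums \<beta>) < card (psums \<alpha>)" by (intro psubset_card_mono) auto
    then have "length \<beta> < length \<alpha>"
      using card_psums in_compsD(1)[OF \<alpha>(1)] in_compsD(1)[OF \<beta>] by simp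
    moreover have "length \<alpha> \<le> n" using length_le_sum_list in_compsD[OF \<alpha>(1)] by metis
    ultimately have "n - length \<alpha> < n - length \<beta>" by simp
    then show ?thesis using \<alpha>(1) by (rule less.hyps)
  qed
  then have "sum (?s c) (?R - {\<beta>}) = sum (?s c') (?R - {\<beta>})" by simp
  moreover have "sum (?s c) ?R = sum (?s c') ?R" using eq[OF \<beta>] .
  ultimately have eq': "?s c \<beta> = ?s c' \<beta>"
    by (simp only: sum.remove[OF fin mem])
  have "(of_nat (pi_pair \<beta> \<beta>) :: rat) \<noteq> 0"
    using pi_pair_nonzero[OF in_compsD(1)[OF \<beta>], of \<beta>] by simp
  with arg_cong[OF eq', of "smult (of_nat (pi_pair \<beta> \<beta>))"] show ?case by simp
qed

text \<open>The left-hand sums are the monomial coefficients of the image under omega of the series with monomial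
  coefficients \<open>a\<close>, see \<open>sum_omega_set\<close>.\<close>

definition psi_expands :: "nat \<Rightarrow> series \<Rightarrow> (nat list \<Rightarrow> rat poly) \<Rightarrow> (nat list \<Rightarrow> rat poly) \<Rightarrow> bool" where
  "psi_expands n L a N \<longleftrightarrow>
     (\<forall>e. L e = (if is_content n e then a (parts e) else 0)) \<and>
     (\<forall>\<alpha>\<in>comps n. nat_poly (N \<alpha>)) \<and>
     (\<forall>\<beta>\<in>comps n. (\<Sum>\<alpha> | \<alpha> \<in> comps n \<and> comp_le \<alpha> \<beta>. (-1) ^ (n + length \<alpha>) * a (rev \<alpha>)) =
        (\<Sum>\<alpha> | \<alpha> \<in> comps n \<and> comp_le \<alpha> \<beta>. smult (inverse (of_nat (pi_pair \<alpha> \<beta>))) (N \<alpha>)))"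

lemma psi_expands_zero: "psi_expands n (\<lambda>_. 0) (\<lambda>_. 0) (\<lambda>_. 0)"
  by (simp add: psi_expands_def nat_poly_def)

lemma psi_expands_add:
  assumes "psi_expands n L a N" "psi_expands n L' a' N'"
  shows "psi_expands n (\<lambda>e. L e + L' e) (\<lambda>\<beta>. a \<beta> + a' \<beta>) (\<lambda>\<beta>. N \<beta> + N' \<beta>)"
  using assms
  by (simp add: psi_expands_def nat_poly_def distrib_left smult_add_right sum.distrib)

text \<open>Multiplication by q; with \<open>psi_expands_add\<close> this is all that the recursion
  \<open>forced_LLT_add_mset\<close> needs.\<close>

lemma psi_expands_mult_X:
  assumes "psi_expands n L a N"
  shows "psi_expands n (\<lambda>e. [:0, 1:] * L e) (\<lambda>\<beta>. [:0, 1:] * a \<beta>) (\<lambda>\<beta>. [:0, 1:] * N \<beta>)"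
  unfolding psi_expands_def
proof (intro conjI allI ballI)
  show "[:0, 1:] * L e = (if is_content n e then [:0, 1:] * a (parts e) else 0)" for e
    using assms by (simp add: psi_expands_def)
  show "nat_poly ([:0, 1:] * N \<alpha>)" if "\<alpha> \<in> comps n" for \<alpha>
    using assms that by (simp add: psi_expands_def nat_poly_def coeff_pCons split: nat.split)
  fix \<beta> assume \<beta>: "\<beta> \<in> comps n"
  have "(\<Sum>\<alpha> | \<alpha> \<in> comps n \<and> comp_le \<alpha> \<beta>. (-1) ^ (n + length \<alpha>) * ([:0, 1:] * a (rev \<alpha>))) =
    [:0, 1:] * (\<Sum>\<alpha> | \<alpha> \<in> comps n \<and> comp_le \<alpha> \<beta>. (-1) ^ (n + length \<alpha>) * a (rev \<alpha>))"
    by (simp only: sum_distrib_left mult.left_commute)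
  also have "(\<Sum>\<alpha> | \<alpha> \<in> comps n \<and> comp_le \<alpha> \<beta>. (-1) ^ (n + length \<alpha>) * a (rev \<alpha>)) =
    (\<Sum>\<alpha> | \<alpha> \<in> comps n \<and> comp_le \<alpha> \<beta>. smult (inverse (of_nat (pi_pair \<alpha> \<beta>))) (N \<alpha>))"
    using assms \<beta> unfolding psi_expands_def by blast
  also have "[:0, 1:] * \<dots> =
    (\<Sum>\<alpha> | \<alpha> \<in> comps n \<and> comp_le \<alpha> \<beta>. smult (inverse (of_nat (pi_pair \<alpha> \<beta>))) ([:0, 1:] * N \<alpha>))"
    by (simp only: sum_distrib_left mult_smult_right)
  finally show "(\<Sum>\<alpha> | \<alpha> \<in> comps n \<and> comp_le \<alpha> \<beta>. (-1) ^ (n + length \<alpha>) * ([:0, 1:] * a (rev \<alpha>))) =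
    (\<Sum>\<alpha> | \<alpha> \<in> comps n \<and> comp_le \<alpha> \<beta>. smult (inverse (of_nat (pi_pair \<alpha> \<beta>))) ([:0, 1:] * N \<alpha>))" .
qed

section \<open>Reduction of the LLT polynomial to colorings with forced ascents\<close>

definition forced_colorings :: "nat \<Rightarrow> (nat \<times> nat) set \<Rightarrow> (nat \<Rightarrow> nat) \<Rightarrow> (nat \<Rightarrow> nat) set" where
  "forced_colorings n R e = {\<kappa> \<in> colorings n. (\<forall>(i, j)\<in>R. \<kappa> i < \<kappa> j) \<and> content n \<kappa> = e}"

text \<open>R holds the edges forced to ascend, D those that still contribute a factor q + 1 when
  they ascend. Forcing an edge twice changes nothing, so R is a set, while D keeps
  multiplicities.\<close>

definition forced_LLT :: "nat \<Rightarrow> (nat \<times> nat) set \<Rightarrow> (nat \<times> nat) multiset \<Rightarrow> series" where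
  "forced_LLT n R D e = (\<Sum>\<kappa>\<in>forced_colorings n R e. [:1, 1:] ^ asc D \<kappa>)"

lemma forced_colorings_empty: "\<not> is_content n e \<Longrightarrow> forced_colorings n R e = {}"
  using is_content_content unfolding forced_colorings_def by blast

lemma finite_forced_colorings: "finite (forced_colorings n R e)"
proof (cases "is_content n e")
  case True
  have "forced_colorings n R e \<subseteq> PiE {1..n} (\<lambda>_. {c. e c \<noteq> 0})"
  proof
    fix \<kappa> assume \<kappa>: "\<kappa> \<in> forced_colorings n R e"
    then have "\<kappa> \<in> extensional {1..n}" "e = content n \<kappa>"
      by (auto simp: forced_colorings_def colorings_def PiE_def)
    moreover have "content n \<kappa> (\<kappa> i) \<noteq> 0" if "i \<in> {1..n}" for i
      using that by (auto simp: content_def)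
    ultimately show "\<kappa> \<in> PiE {1..n} (\<lambda>_. {c. e c \<noteq> 0})" by (simp add: PiE_iff)
  qed
  then show ?thesis
    by (rule finite_subset) (use True in \<open>auto simp: is_content_def intro: finite_PiE\<close>)
qed (simp add: forced_colorings_empty)

text \<open>All edges of S ascend in the colorings counted, so the truncated subtraction of
  \<open>size S\<close> is exact and removes S from the ascent count.\<close>

lemma LLT_at_eq_forced_LLT:
  assumes "S \<subseteq># E"
  shows "LLT_at n E S [:1, 1:] = forced_LLT n (set_mset S) (E - S)"
proof
  fix e
  have "asc E \<kappa> - size S = asc (E - S) \<kappa>" if "\<kappa> \<in> forced_colorings n (set_mset S) e" for \<kappa>
  proof -
    have "asc E \<kappa> = asc S \<kappa> + asc (E - S) \<kappa>"
      unfolding asc_def by (metis assms filter_union_mset size_union subset_mset.add_diff_inverse)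
    moreover have "filter_mset (\<lambda>(i, j). \<kappa> i < \<kappa> j) S = S"
      using that unfolding forced_colorings_def filter_mset_eq_conv by auto
    ultimately show ?thesis by (simp add: asc_def)
  qed
  then show "LLT_at n E S [:1, 1:] e = forced_LLT n (set_mset S) (E - S) e"
    unfolding LLT_at_def forced_LLT_def forced_colorings_def by (intro sum.cong) auto
qed

text \<open>An edge contributes q + 1 or 1, that is, 1 plus q times the indicator of its ascent; the
  indicator turns it into a forced edge.\<close>

lemma forced_LLT_add_mset:
  "forced_LLT n R (add_mset (i, j) D) e = forced_LLT n R D e + [:0, 1:] * forced_LLT n (insert (i, j) R) D e"
proof -
  let ?Q = "\<lambda>\<kappa>. [:1, 1:] ^ asc D \<kappa> :: rat poly"
  have "[:1, 1:] ^ asc (add_mset (i, j) D) \<kappa> = ?Q \<kappa> + (if \<kappa> i < \<kappa> j then [:0, 1:] * ?Q \<kappa> else 0)" for \<kappa>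
  proof (cases "\<kappa> i < \<kappa> j")
    case True
    have "([:1, 1:] :: rat poly) = 1 + [:0, 1:]" by (simp add: one_pCons)
    then have "([:1, 1:] :: rat poly) * x = x + [:0, 1:] * x" for x
      by (metis distrib_right mult_1)
    then show ?thesis using True by (simp add: asc_def)
  qed (simp add: asc_def)
  then have "forced_LLT n R (add_mset (i, j) D) e = forced_LLT n R D e +
    (\<Sum>\<kappa>\<in>forced_colorings n R e. if \<kappa> i < \<kappa> j then [:0, 1:] * ?Q \<kappa> else 0)"
    unfolding forced_LLT_def by (simp only: sum.distrib)
  also have "(\<Sum>\<kappa>\<in>forced_colorings n R e. if \<kappa> i < \<kappa> j then [:0, 1:] * ?Q \<kappa> else 0) =
    (\<Sum>\<kappa> | \<kappa> \<in> forced_colorings n R e \<and> \<kappa> i < \<kappa> j. [:0, 1:] * ?Q \<kappa>)"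
    by (rule sum.inter_filter[symmetric, OF finite_forced_colorings])
  also have "{\<kappa>. \<kappa> \<in> forced_colorings n R e \<and> \<kappa> i < \<kappa> j} = forced_colorings n (insert (i, j) R) e"
    by (auto simp: forced_colorings_def)
  also have "(\<Sum>\<kappa>\<in>forced_colorings n (insert (i, j) R) e. [:0, 1:] * ?Q \<kappa>) =
    [:0, 1:] * forced_LLT n (insert (i, j) R) D e"
    unfolding forced_LLT_def by (simp only: sum_distrib_left)
  finally show ?thesis .
qed

text \<open>Used twice: to replace R by the order it generates, and, at a pair (i, i), to exclude
  every coloring when R has a cycle.\<close>

lemma trancl_less:
  assumes "\<forall>(i, j)\<in>R. \<kappa> i < (\<kappa> j :: nat)" "(i, j) \<in> R\<^sup>+"
  shows "\<kappa> i < \<kappa> j"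
  using assms(2)
proof (induction rule: trancl_induct)
  case (base y)
  then show ?case using assms(1) by blast
next
  case (step y z)
  then have "\<kappa> y < \<kappa> z" using assms(1) by blast
  with step.IH show ?case by simp
qed

lemma card_forced_colorings:
  assumes "R \<subseteq> {1..n} \<times> {1..n}" and e: "is_content n e"
  shows "card (forced_colorings n R e) = chains (minimal_sets (R\<^sup>+)) (parts e) {1..n}"
proof -
  let ?s = "sorted_list_of_set {c. e c \<noteq> 0}"
  let ?X = "{1..n}"
  have fin: "finite {c. e c \<noteq> 0}" and e0: "e 0 = 0" using e by (auto simp: is_content_def)
  have set_s: "set ?s = {c. e c \<noteq> 0}" by (rule set_sorted_list_of_set[OF fin])
  have e_eq: "(if c \<in> set ?s then e c else 0) = e c" for c unfolding set_s by simp
  let ?K = "{\<kappa> \<in> PiE ?X (\<lambda>_. UNIV). (\<forall>i\<in>?X. \<forall>j\<in>?X. (i, j) \<in> R\<^sup>+ \<longrightarrow> \<kappa> i < \<kappa> j) \<and>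
      (\<forall>c. card {i \<in> ?X. \<kappa> i = c} = (if c \<in> set ?s then e c else 0))}"
  have K: "forced_colorings n R e = ?K"
  proof (intro equalityI subsetI)
    fix \<kappa> assume \<kappa>: "\<kappa> \<in> forced_colorings n R e"
    then have "\<kappa> \<in> PiE ?X (\<lambda>_. UNIV)" "\<forall>(i, j)\<in>R. \<kappa> i < \<kappa> j" "content n \<kappa> = e"
      by (auto simp: forced_colorings_def colorings_def PiE_def)
    then show "\<kappa> \<in> ?K" unfolding e_eq using trancl_less[of R \<kappa>] by (simp add: content_def fun_eq_iff)
  next
    fix \<kappa> assume "\<kappa> \<in> ?K"
    then have \<kappa>: "\<kappa> \<in> PiE ?X (\<lambda>_. UNIV)" "\<And>i j. i \<in> ?X \<Longrightarrow> j \<in> ?X \<Longrightarrow> (i, j) \<in> R\<^sup>+ \<Longrightarrow> \<kappa> i < \<kappa> j"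
      "\<And>c. card {i \<in> ?X. \<kappa> i = c} = e c"
      unfolding e_eq by blast+
    \<comment> \<open>Maps in \<open>?K\<close> could take the value 0 as far as their codomain is
      concerned; the content forbids it because \<open>e 0 = 0\<close>.\<close>
    have "\<kappa> i \<in> {1..}" if "i \<in> ?X" for i
    proof -
      have "card {k \<in> ?X. \<kappa> k = \<kappa> i} \<noteq> 0" using that by auto
      then have "\<kappa> i \<noteq> 0" using \<kappa>(3)[of "\<kappa> i"] e0 by metis
      then show ?thesis by (simp add: Suc_le_eq)
    qed
    then have "\<kappa> \<in> colorings n" using \<kappa>(1) by (simp add: colorings_def PiE_iff)
    moreover have "\<kappa> i < \<kappa> j" if "(i, j) \<in> R" for i j
      using \<kappa>(2)[of i j] that assms(1) by blast
    moreover have "content n \<kappa> = e" using \<kappa>(3) by (simp add: content_def fun_eq_iff)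
    ultimately show "\<kappa> \<in> forced_colorings n R e" unfolding forced_colorings_def by blast
  qed
  have "card ?K = chains (minimal_sets (R\<^sup>+)) (map e ?s) ?X"
    by (rule card_colorings_eq_chains) (simp, rule strict_sorted_list_of_set, unfold set_s, blast)
  then show ?thesis unfolding parts_def K .
qed

lemma sum_const_poly: "(\<Sum>x\<in>A. [:f x:]) = [:sum f A:]"
  by (induction A rule: infinite_finite_induct) auto

lemma psi_expands_forced_LLT_empty:
  assumes R: "R \<subseteq> {1..n} \<times> {1..n}"
  shows "\<exists>a N. psi_expands n (forced_LLT n R {#}) a N"
proof (cases "irrefl (R\<^sup>+)")
  case False
  then obtain i where "(i, i) \<in> R\<^sup>+" by (auto simp: irrefl_def)
  then have "forced_colorings n R e = {}" for e
    using trancl_less[of R _ i i] unfolding forced_colorings_def by blast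
  then have "forced_LLT n R {#} = (\<lambda>_. 0)" by (simp add: forced_LLT_def fun_eq_iff)
  then show ?thesis using psi_expands_zero by auto
next
  case True
  interpret strict_order "R\<^sup>+" by standard (use True in simp_all)
  define a where "a \<beta> = [:of_nat (chains (minimal_sets (R\<^sup>+)) \<beta> {1..n}) :: rat:]" for \<beta>
  \<comment> \<open>The Psi-coefficients: numbers of ordered partitions into principal down-sets of
    what remains, with the sizes \<alpha> read backwards. As D is empty, no power of q
    occurs.\<close>
  define N where "N \<alpha> = [:of_nat (chains (down_sets (R\<^sup>+)) (rev \<alpha>) {1..n}) :: rat:]" for \<alpha>
  have "forced_LLT n R {#} e = (if is_content n e then a (parts e) else 0)" for e
    using card_forced_colorings[OF R, of e]
    by (simp add: forced_LLT_def asc_def a_def forced_colorings_empty of_nat_poly)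
  moreover have "nat_poly (N \<alpha>)" for \<alpha>
    by (simp add: nat_poly_def N_def coeff_pCons split: nat.split)
  moreover have "(\<Sum>\<alpha> | \<alpha> \<in> comps n \<and> comp_le \<alpha> \<beta>. (-1) ^ (n + length \<alpha>) * a (rev \<alpha>)) =
        (\<Sum>\<alpha> | \<alpha> \<in> comps n \<and> comp_le \<alpha> \<beta>. smult (inverse (of_nat (pi_pair \<alpha> \<beta>))) (N \<alpha>))"
    if "\<beta> \<in> comps n" for \<beta>
  proof -
    have sign: "(-1) ^ k * [:x:] = [:(-1) ^ k * x:]" for k and x :: rat
      by (cases "even k") simp_all
    have "(\<Sum>\<alpha> | \<alpha> \<in> comps n \<and> comp_le \<alpha> \<beta>.
        (-1) ^ (n + length \<alpha>) * of_nat (chains (minimal_sets (R\<^sup>+)) (rev \<alpha>) {1..n})) =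
      (\<Sum>\<alpha> | \<alpha> \<in> comps n \<and> comp_le \<alpha> \<beta>.
        inverse (of_nat (pi_pair \<alpha> \<beta>)) * of_nat (chains (down_sets (R\<^sup>+)) (rev \<alpha>) {1..n}) :: rat)"
      using chains_reciprocity[of "{1..n}" \<beta>] that by simp
    then show ?thesis
      unfolding a_def N_def sign smult_pCons smult_0_right sum_const_poly by (simp only:)
  qed
  ultimately show ?thesis unfolding psi_expands_def by blast
qed

text \<open>Induction on D for all R at once, because each step also needs the case where the edge
  has moved into R.\<close>

lemma psi_expands_forced_LLT:
  assumes "R \<subseteq> {1..n} \<times> {1..n}" "set_mset D \<subseteq> {1..n} \<times> {1..n}"
  shows "\<exists>a N. psi_expands n (forced_LLT n R D) a N"
  using assms
proof (induction D arbitrary: R)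
  case empty
  then show ?case by (intro psi_expands_forced_LLT_empty)
next
  case (add x D)
  obtain i j where x: "x = (i, j)" by (cases x)
  obtain a N where "psi_expands n (forced_LLT n R D) a N"
    using add.IH[of R] add.prems by auto
  moreover have "\<exists>a N. psi_expands n (forced_LLT n (insert (i, j) R) D) a N"
    by (rule add.IH) (use add.prems x in auto)
  then obtain a' N' where "psi_expands n (forced_LLT n (insert (i, j) R) D) a' N'" by blast
  ultimately have "psi_expands n (\<lambda>e. forced_LLT n R D e + [:0, 1:] * forced_LLT n (insert (i, j) R) D e)
      (\<lambda>\<beta>. a \<beta> + [:0, 1:] * a' \<beta>) (\<lambda>\<beta>. N \<beta> + [:0, 1:] * N' \<beta>)"
    by (intro psi_expands_add psi_expands_mult_X)
  then show ?case unfolding x forced_LLT_add_mset[abs_def] by blast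
qed

theorem theorem7p9:
  fixes n :: nat and E S :: "(nat \<times> nat) multiset"
  assumes "set_mset E \<subseteq> {1..n} \<times> {1..n}"
    and "S \<subseteq># E"
  shows "(\<exists>d. LLT_at n E S [:1, 1:] = Fseries n d) \<and>
    (\<forall>d. LLT_at n E S [:1, 1:] = Fseries n d \<longrightarrow>
       (\<exists>c. Fseries n (\<lambda>T. d (omega_set n T)) = Psi_expansion n c) \<and>
       (\<forall>c. Fseries n (\<lambda>T. d (omega_set n T)) = Psi_expansion n c \<longrightarrow>
            (\<forall>\<alpha> \<in> comps n. nat_poly (c \<alpha>))))"
proof -
  have "set_mset S \<subseteq> {1..n} \<times> {1..n}" "set_mset (E - S) \<subseteq> {1..n} \<times> {1..n}"
    using assms by (auto dest: mset_subset_eqD in_diffD)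
  then obtain a N where "psi_expands n (LLT_at n E S [:1, 1:]) a N"
    unfolding LLT_at_eq_forced_LLT[OF assms(2)] using psi_expands_forced_LLT by blast
  then have
    a: "\<And>e. LLT_at n E S [:1, 1:] e = (if is_content n e then a (parts e) else 0)"
    and N: "\<And>\<alpha>. \<alpha> \<in> comps n \<Longrightarrow> nat_poly (N \<alpha>)"
    and aN: "\<And>\<beta>. \<beta> \<in> comps n \<Longrightarrow>
      (\<Sum>\<alpha> | \<alpha> \<in> comps n \<and> comp_le \<alpha> \<beta>. (-1) ^ (n + length \<alpha>) * a (rev \<alpha>)) =
      (\<Sum>\<alpha> | \<alpha> \<in> comps n \<and> comp_le \<alpha> \<beta>. smult (inverse (of_nat (pi_pair \<alpha> \<beta>))) (N \<alpha>))"
    unfolding psi_expands_def by blast+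
  obtain d where "\<forall>\<beta>\<in>comps n. sum d (Pow (Sset \<beta>)) = a \<beta>" using ex_sum_Pow_Sset by blast
  then have "LLT_at n E S [:1, 1:] = Fseries n d"
    unfolding fun_eq_iff a Fseries_eq using parts_in_comps by simp
  moreover have "\<exists>c. Fseries n (\<lambda>T. d (omega_set n T)) = Psi_expansion n c" (is ?ex)
    and "\<forall>c. Fseries n (\<lambda>T. d (omega_set n T)) = Psi_expansion n c \<longrightarrow> (\<forall>\<alpha>\<in>comps n. nat_poly (c \<alpha>))" (is ?pos)
    if d: "LLT_at n E S [:1, 1:] = Fseries n d" for d
  proof -
    \<comment> \<open>An arbitrary d has the same subset sums, read off at a monomial with exponent
      composition \<beta>.\<close>
    have "sum d (Pow (Sset \<beta>)) = a \<beta>" if \<beta>: "\<beta> \<in> comps n" for \<beta>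
    proof -
      obtain e where "is_content n e" "parts e = \<beta>" using ex_is_content[OF \<beta>] by blast
      then show ?thesis using a[of e] unfolding d Fseries_eq by simp
    qed
    then have sums: "(\<Sum>T\<in>Pow (Sset \<beta>). d (omega_set n T)) =
      (\<Sum>\<alpha> | \<alpha> \<in> comps n \<and> comp_le \<alpha> \<beta>. smult (inverse (of_nat (pi_pair \<alpha> \<beta>))) (N \<alpha>))"
      if "\<beta> \<in> comps n" for \<beta>
      using sum_omega_set[of n d a \<beta>] aN[OF that] that by simp
    then have "Fseries n (\<lambda>T. d (omega_set n T)) = Psi_expansion n N"
      unfolding fun_eq_iff Fseries_eq Psi_expansion_eq using parts_in_comps by simp
    then show ?ex by blast
    show ?pos
    proof (intro allI impI ballI)
      fix c \<alpha> assume c: "Fseries n (\<lambda>T. d (omega_set n T)) = Psi_expansion n c" and \<alpha>: "\<alpha> \<in> comps n"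
      \<comment> \<open>Uniqueness carries positivity from the counted coefficients to an arbitrary
        expansion c.\<close>
      have "c \<alpha> = N \<alpha>"
      proof (rule Psi_coefficients_unique[OF _ \<alpha>])
        fix \<beta> assume \<beta>: "\<beta> \<in> comps n"
        obtain e where e: "is_content n e" "parts e = \<beta>" using ex_is_content[OF \<beta>] by blast
        have "Psi_expansion n c e = (\<Sum>T\<in>Pow (Sset \<beta>). d (omega_set n T))"
          unfolding c[symmetric] Fseries_eq using e by simp
        then show "(\<Sum>\<alpha> | \<alpha> \<in> comps n \<and> comp_le \<alpha> \<beta>. smult (inverse (of_nat (pi_pair \<alpha> \<beta>))) (c \<alpha>)) =
          (\<Sum>\<alpha> | \<alpha> \<in> comps n \<and> comp_le \<alpha> \<beta>. smult (inverse (of_nat (pi_pair \<alpha> \<beta>))) (N \<alpha>))"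
          unfolding sums[OF \<beta>] Psi_expansion_eq using e by simp
      qed
      then show "nat_poly (c \<alpha>)" using N[OF \<alpha>] by simp
    qed
  qed
  ultimately show ?thesis by blast
qed

end
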